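(* Let $A,B\in\mathbb{B}(\mathscr{H})$ be positive invertible operators, let $0\le v\le 1$, and let $g:[0,1]\to\mathbb{R}$ be non-decreasing on $[0,1]$ with $g(1)\ne g(0)$. Then \[ A\sharp_v B+\frac{4}{g(1)-g(0)}\left[\int_{0}^{1}(A\,m_{t,v}\,B)\,g(t)\,dt-\int_{0}^{1}(A\,m_{t,v}\,B)\,dt\int_{0}^{1}g(t)\,dt\right]\le A\nabla_v B . \]
   Context: $\le$ is the Loewner order on bounded operators on a complex Hilbert space $\mathscr{H}$. For positive invertible $A,B$, $0\le v\le1$ and $-1\le t\le 1$, $t\ne0$: $A\,m_{t,v}\,B=A^{1/2}\left((1-v)I+v\left(A^{-1/2}BA^{-1/2}\right)^{t}\right)^{1/t}A^{1/2}$, and $A\,m_{0,v}\,B:=A\sharp_v B=A^{1/2}(A^{-1/2}BA^{-1/2})^{v}A^{1/2}$. Also $A\nabla_v B=(1-v)A+vB$. *)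

theory Defs
  imports "HOL-Analysis.Analysis"
begin

type_synonym 'a op = "'a \<Rightarrow>\<^sub>L 'a"

definition selfadj :: "('a::real_inner) op \<Rightarrow> bool" where
  "selfadj A \<longleftrightarrow> (\<forall>x y. inner (A x) y = inner x (A y))"

definition positive_op :: "('a::real_inner) op \<Rightarrow> bool" where
  "positive_op A \<longleftrightarrow> selfadj A \<and> (\<forall>x. 0 \<le> inner (A x) x)"

definition loewner_le :: "('a::real_inner) op \<Rightarrow> 'a op \<Rightarrow> bool" where
  "loewner_le A B \<longleftrightarrow> positive_op (B - A)"

definition invertible_op :: "('a::real_normed_vector) op \<Rightarrow> bool" where
  "invertible_op A \<longleftrightarrow> (\<exists>C. A o\<^sub>L C = id_blinfun \<and> C o\<^sub>L A = id_blinfun)"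

definition pos_invertible :: "('a::real_inner) op \<Rightarrow> bool" where
  "pos_invertible A \<longleftrightarrow> positive_op A \<and> invertible_op A"

text \<open>Functional calculus for real powers of positive invertible operators,
  realised through norm-convergent power series:
  A^t = exp(t log A), with log A = ln c I + log(A/c), c = norm A + 1,
  log(A/c) = - sum_{k>=1} (I - A/c)^k / k.\<close>

definition opow :: "('a::real_normed_vector) op \<Rightarrow> nat \<Rightarrow> 'a op" where
  "opow X k = ((\<lambda>Y. X o\<^sub>L Y) ^^ k) id_blinfun"

definition op_exp :: "('a::{real_normed_vector, complete_space}) op \<Rightarrow> 'a op" where
  "op_exp X = (\<Sum>k. (1 / fact k) *\<^sub>R opow X k)"

definition op_ln :: "('a::{real_normed_vector, complete_space}) op \<Rightarrow> 'a op" where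
  "op_ln A = (let c = norm A + 1 in
     ln c *\<^sub>R id_blinfun
     - (\<Sum>k. (1 / real (Suc k)) *\<^sub>R opow (id_blinfun - (1 / c) *\<^sub>R A) (Suc k)))"

definition op_powr :: "('a::{real_normed_vector, complete_space}) op \<Rightarrow> real \<Rightarrow> 'a op" where
  "op_powr A t = op_exp (t *\<^sub>R op_ln A)"

definition gmean :: "('a::{real_normed_vector, complete_space}) op \<Rightarrow> real \<Rightarrow> 'a op \<Rightarrow> 'a op" where
  "gmean A v B =
     op_powr A (1/2) o\<^sub>L
     op_powr (op_powr A (-1/2) o\<^sub>L B o\<^sub>L op_powr A (-1/2)) v o\<^sub>L
     op_powr A (1/2)"

definition pmean :: "real \<Rightarrow> real \<Rightarrow> ('a::{real_normed_vector, complete_space}) op \<Rightarrow> 'a op \<Rightarrow> 'a op" where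
  "pmean t v A B =
     (if t = 0 then gmean A v B
      else op_powr A (1/2) o\<^sub>L
           op_powr ((1 - v) *\<^sub>R id_blinfun
                    + v *\<^sub>R op_powr (op_powr A (-1/2) o\<^sub>L B o\<^sub>L op_powr A (-1/2)) t) (1/t) o\<^sub>L
           op_powr A (1/2))"

definition amean :: "('a::real_normed_vector) op \<Rightarrow> real \<Rightarrow> 'a op \<Rightarrow> 'a op" where
  "amean A v B = (1 - v) *\<^sub>R A + v *\<^sub>R B"

end

theory Submission
  imports Defs
begin

text \<open>Write \<open>X = A\<^sup>-\<^sup>1\<^sup>/\<^sup>2 B A\<^sup>-\<^sup>1\<^sup>/\<^sup>2\<close>. The scalar power means \<open>((1 - v) + v x\<^sup>t)\<^sup>1\<^sup>/\<^sup>t\<close> increase with \<open>t\<close> and are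
  jointly continuous in \<open>(t, x)\<close> down to \<open>t = 0\<close>, so by the continuous functional calculus of \<open>X\<close> the path
  \<open>t \<mapsto> A m\<^sub>t B\<close> is norm continuous and monotone from \<open>A # B\<close> at \<open>0\<close> to the arithmetic mean at \<open>1\<close>. For a
  fixed vector the claim is then the scalar Gruess inequality with constant \<open>1/4\<close>.

  The functional calculus on \<open>[0, 1]\<close> is the limit of Bernstein polynomials: for \<open>0 \<le> T \<le> 1\<close> the operators
  \<open>T\<^sup>k (1 - T)\<^sup>n\<^sup>-\<^sup>k\<close> are positive, which yields the norm bound \<open>\<parallel>p(T)\<parallel> \<le> sup \<bar>p\<bar>\<close>. Power series of
  operators are identified with functions through uniform convergence.\<close>

text \<open>The sort \<open>{real_normed_vector, complete_space}\<close> does not entail the class \<^class>\<open>banach\<close>, although it has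
  the same axioms; this arity makes the integration theory apply to operators on such a space.\<close>

instance blinfun :: (real_normed_vector, "{real_normed_vector,complete_space}") banach
proof
  fix X :: "nat \<Rightarrow> 'a \<Rightarrow>\<^sub>L 'b"
  assume X: "Cauchy X"
  have bd: "norm (X m x - X n x) \<le> norm (X m - X n) * norm x" for m n x
    using norm_blinfun[of "X m - X n" x] by (simp add: blinfun.diff_left)
  have "\<exists>l. (\<lambda>n. X n x) \<longlonglongrightarrow> l" for x
  proof -
    have "Cauchy (\<lambda>n. X n x)"
    proof (rule CauchyI)
      fix e :: real assume "0 < e"
      then have "0 < e / (norm x + 1)" by (simp add: add_nonneg_pos)
      from CauchyD[OF X this] obtain M where
        M: "\<And>m n. m \<ge> M \<Longrightarrow> n \<ge> M \<Longrightarrow> norm (X m - X n) < e / (norm x + 1)" by blast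
      have "norm (X m x - X n x) < e" if "m \<ge> M" "n \<ge> M" for m n
      proof -
        have "norm (X m - X n) * norm x \<le> norm (X m - X n) * (norm x + 1)"
          by (simp add: mult_left_mono)
        also have "\<dots> < e" using M[OF that] by (simp add: pos_less_divide_eq add_nonneg_pos)
        finally show ?thesis using bd[of m x n] by linarith
      qed
      then show "\<exists>M. \<forall>m\<ge>M. \<forall>n\<ge>M. norm (X m x - X n x) < e" by blast
    qed
    then show ?thesis using Cauchy_convergent convergent_def by blast
  qed
  then obtain l where l: "\<And>x. (\<lambda>n. X n x) \<longlonglongrightarrow> l x" by metis
  obtain K where K: "\<And>n. norm (X n) \<le> K"
    using Cauchy_Bseq[OF X] by (auto simp: Bseq_def)
  \<comment> \<open>A Cauchy sequence is norm bounded; the bound survives the pointwise limit and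
    makes \<open>l\<close> bounded.\<close>
  have "norm (l x) \<le> norm x * K" for x
  proof (rule LIMSEQ_le_const2[OF tendsto_norm[OF l]], intro exI allI impI)
    show "norm (X n x) \<le> norm x * K" for n
      using norm_blinfun[of "X n" x] K[of n] by (smt (verit) mult.commute mult_left_mono norm_ge_zero)
  qed
  moreover have "l (x + y) = l x + l y" for x y
    using tendsto_add[OF l[of x] l[of y]] l[of "x + y"]
    by (auto simp: blinfun.add_right intro: LIMSEQ_unique)
  moreover have "l (r *\<^sub>R x) = r *\<^sub>R l x" for r x
    using tendsto_scaleR[OF tendsto_const l[of x], of r] l[of "r *\<^sub>R x"]
    by (auto simp: blinfun.scaleR_right intro: LIMSEQ_unique)
  ultimately have bl: "bounded_linear l" by (rule bounded_linear_intro[rotated 2])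
  have "X \<longlonglongrightarrow> Blinfun l"
  proof (rule LIMSEQ_I)
    fix e :: real assume "0 < e"
    then have "0 < e / 2" by simp
    from CauchyD[OF X this] obtain M where
      M: "\<And>m n. m \<ge> M \<Longrightarrow> n \<ge> M \<Longrightarrow> norm (X m - X n) < e / 2" by blast
    have "norm (X n - Blinfun l) \<le> e / 2" if "n \<ge> M" for n
    proof (rule norm_blinfun_bound)
      fix x
      \<comment> \<open>Letting \<open>m\<close> tend to infinity at fixed \<open>x\<close> gives an
        estimate whose constant does not depend on \<open>x\<close>, hence norm convergence.\<close>
      have "norm (X n x - l x) \<le> e / 2 * norm x"
      proof (rule LIMSEQ_le_const2[OF tendsto_norm[OF tendsto_diff[OF tendsto_const l]]],
          intro exI allI impI)
        fix m assume "m \<ge> M"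
        with M[OF that] show "norm (X n x - X m x) \<le> e / 2 * norm x"
          by (smt (verit) bd mult_right_mono norm_ge_zero)
      qed
      then show "norm ((X n - Blinfun l) x) \<le> e / 2 * norm x"
        by (simp add: blinfun.diff_left bounded_linear_Blinfun_apply[OF bl])
    qed (use \<open>0 < e\<close> in simp)
    then show "\<exists>M. \<forall>n\<ge>M. norm (X n - Blinfun l) < e"
      using \<open>0 < e\<close> by (intro exI[of _ M]) fastforce
  qed
  then show "convergent X" by (rule convergentI)
qed


section \<open>Positive operators and polynomials in a contraction\<close>

lemmas op_bilinear = bounded_bilinear.add_left[OF bounded_bilinear_blinfun_compose]
  bounded_bilinear.add_right[OF bounded_bilinear_blinfun_compose]
  bounded_bilinear.diff_left[OF bounded_bilinear_blinfun_compose]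
  bounded_bilinear.diff_right[OF bounded_bilinear_blinfun_compose]
  bounded_bilinear.minus_left[OF bounded_bilinear_blinfun_compose]
  bounded_bilinear.minus_right[OF bounded_bilinear_blinfun_compose]
  bounded_bilinear.scaleR_left[OF bounded_bilinear_blinfun_compose]
  bounded_bilinear.scaleR_right[OF bounded_bilinear_blinfun_compose]

lemma opow_0 [simp]: "opow X 0 = id_blinfun"
  and opow_Suc: "opow X (Suc k) = X o\<^sub>L opow X k"
  by (simp_all add: opow_def)

lemma op_compose_assoc: "(X o\<^sub>L Y) o\<^sub>L Z = X o\<^sub>L (Y o\<^sub>L Z)"
  by (auto intro: blinfun_eqI)

lemma id_compose [simp]: "id_blinfun o\<^sub>L X = X" "X o\<^sub>L id_blinfun = X"
  by (auto intro: blinfun_eqI)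

lemma selfadj_0 [simp]: "selfadj 0" and selfadj_id [simp]: "selfadj id_blinfun"
  by (simp_all add: selfadj_def)

lemma selfadj_add: "selfadj X \<Longrightarrow> selfadj Y \<Longrightarrow> selfadj (X + Y)"
  and selfadj_diff: "selfadj X \<Longrightarrow> selfadj Y \<Longrightarrow> selfadj (X - Y)"
  and selfadj_scaleR: "selfadj X \<Longrightarrow> selfadj (c *\<^sub>R X)"
  by (simp_all add: selfadj_def blinfun.bilinear_simps inner_simps)

lemma selfadj_compose: "selfadj X \<Longrightarrow> selfadj Y \<Longrightarrow> X o\<^sub>L Y = Y o\<^sub>L X \<Longrightarrow> selfadj (X o\<^sub>L Y)"
  unfolding selfadj_def by (metis blinfun_apply_blinfun_compose)

lemma selfadj_sandwich: "selfadj S \<Longrightarrow> selfadj X \<Longrightarrow> selfadj (S o\<^sub>L X o\<^sub>L S)"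
  by (simp add: selfadj_def)

lemma tendsto_inner_op:
  "X \<longlonglongrightarrow> L \<Longrightarrow> (\<lambda>n. inner (blinfun_apply (X n) x) y) \<longlonglongrightarrow> inner (L x) y"
  by (intro tendsto_intros)

lemma selfadj_LIMSEQ:
  assumes "X \<longlonglongrightarrow> L" "\<And>n. selfadj (X n)" shows "selfadj L"
  unfolding selfadj_def
proof (intro allI)
  fix x y
  have "(\<lambda>n. inner (X n x) y) \<longlonglongrightarrow> inner x (L y)"
    using tendsto_inner_op[OF assms(1), of y x] assms(2) by (simp add: selfadj_def inner_commute)
  then show "inner (L x) y = inner x (L y)"
    using tendsto_inner_op[OF assms(1)] LIMSEQ_unique by blast
qed

lemma positive_op_0 [simp]: "positive_op 0" and positive_op_id [simp]: "positive_op id_blinfun"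
  by (simp_all add: positive_op_def)

lemma positive_op_add: "positive_op X \<Longrightarrow> positive_op Y \<Longrightarrow> positive_op (X + Y)"
  by (simp add: positive_op_def selfadj_add blinfun.bilinear_simps inner_simps)

lemma positive_op_scaleR: "0 \<le> c \<Longrightarrow> positive_op X \<Longrightarrow> positive_op (c *\<^sub>R X)"
  by (simp add: positive_op_def selfadj_scaleR blinfun.bilinear_simps)

lemma positive_op_sum: "(\<And>k. k \<in> I \<Longrightarrow> positive_op (X k)) \<Longrightarrow> positive_op (\<Sum>k\<in>I. X k)"
  by (induction I rule: infinite_finite_induct) (auto intro: positive_op_add)

lemma positive_op_sandwich: "selfadj S \<Longrightarrow> positive_op X \<Longrightarrow> positive_op (S o\<^sub>L X o\<^sub>L S)"
  unfolding positive_op_def by (metis selfadj_sandwich selfadj_def blinfun_apply_blinfun_compose)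

lemma positive_op_LIMSEQ:
  assumes "X \<longlonglongrightarrow> L" "\<And>n. positive_op (X n)" shows "positive_op L"
  using assms selfadj_LIMSEQ[OF assms(1)] LIMSEQ_le_const[OF tendsto_inner_op[OF assms(1)]]
  unfolding positive_op_def by blast

text \<open>Polarization: the two hypotheses bound the quadratic form of \<open>S\<close>, and
  symmetry carries the bound over to the bilinear form. The norm estimates of the calculus rest on
  this, and the case \<open>M = 0\<close> serves to show that an operator vanishes.\<close>

lemma norm_op_le:
  assumes "positive_op (M *\<^sub>R id_blinfun - S)" "positive_op (M *\<^sub>R id_blinfun + S)" "0 \<le> M"
  shows "norm S \<le> M"
proof (rule norm_blinfun_bound)
  have q: "\<bar>inner (S x) x\<bar> \<le> M * (norm x)\<^sup>2" for x
    using assms(1,2)[unfolded positive_op_def, THEN conjunct2, rule_format, of x]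
    by (simp add: blinfun.bilinear_simps inner_simps power2_norm_eq_inner abs_le_iff)
  \<comment> \<open>Symmetry of \<open>S\<close> is recovered by writing \<open>S\<close> as half
    the difference of two self-adjoint operators.\<close>
  have "selfadj ((1/2) *\<^sub>R ((M *\<^sub>R id_blinfun + S) - (M *\<^sub>R id_blinfun - S)))"
    using assms(1,2) unfolding positive_op_def by (blast intro: selfadj_scaleR selfadj_diff)
  moreover have "(1/2) *\<^sub>R ((M *\<^sub>R id_blinfun + S) - (M *\<^sub>R id_blinfun - S)) = S"
    by (simp add: algebra_simps flip: scaleR_add_left)
  ultimately have sa: "inner (S x) y = inner x (S y)" for x y
    by (simp add: selfadj_def)
  have pol: "2 * inner (S x) y \<le> M * ((norm x)\<^sup>2 + (norm y)\<^sup>2)" for x y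
  proof -
    have "4 * inner (S x) y = inner (S (x + y)) (x + y) - inner (S (x - y)) (x - y)"
      using sa[of y x] inner_commute[of y "S x"] by (simp add: blinfun.bilinear_simps inner_simps)
    also have "\<dots> \<le> M * (norm (x + y))\<^sup>2 + M * (norm (x - y))\<^sup>2"
      using q[of "x + y"] q[of "x - y"] by linarith
    also have "\<dots> = 2 * (M * ((norm x)\<^sup>2 + (norm y)\<^sup>2))"
      by (simp add: power2_norm_eq_inner inner_simps inner_commute algebra_simps)
    finally show ?thesis by linarith
  qed
  show "norm (S x) \<le> M * norm x" for x
  proof (cases "norm (S x) = 0 \<or> norm x = 0")
    case True
    then show ?thesis using assms(3) by (auto simp: blinfun.zero_right)
  next
    case False
    \<comment> \<open>Rescaling \<open>S x\<close> to the length of \<open>x\<close> balances the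
      two squares in \<open>pol\<close>.\<close>
    define y where "y = (norm x / norm (S x)) *\<^sub>R S x"
    have "norm y = norm x" using False by (simp add: y_def)
    moreover have "inner (S x) y = norm x * norm (S x)"
      using False by (simp add: y_def power2_norm_eq_inner[symmetric] power2_eq_square)
    ultimately have "norm x * norm (S x) \<le> norm x * (M * norm x)"
      using pol[of x y] by (simp add: power2_eq_square algebra_simps)
    then show ?thesis using False by (simp add: mult_le_cancel_left)
  qed
qed (fact assms(3))

lemma positive_op_norm_diff:
  assumes "selfadj X" "norm X \<le> c"
  shows "positive_op (c *\<^sub>R id_blinfun - X)"
  unfolding positive_op_def
proof (intro conjI allI selfadj_diff selfadj_scaleR selfadj_id assms(1))
  fix x
  have "inner (X x) x \<le> norm (X x) * norm x" by (rule norm_cauchy_schwarz)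
  also have "\<dots> \<le> (norm X * norm x) * norm x"
    by (intro mult_right_mono norm_blinfun) auto
  also have "\<dots> \<le> c * (norm x * norm x)"
    using assms(2) by (simp add: mult_right_mono mult.assoc)
  finally show "0 \<le> inner ((c *\<^sub>R id_blinfun - X) x) x"
    by (simp add: blinfun.bilinear_simps inner_simps power2_norm_eq_inner[symmetric] power2_eq_square)
qed

section \<open>Polynomials of an operator and their Bernstein forms\<close>

definition op_poly :: "('a::real_normed_vector) op \<Rightarrow> real poly \<Rightarrow> 'a op" where
  "op_poly T p = fold_coeffs (\<lambda>a S. a *\<^sub>R id_blinfun + (T o\<^sub>L S)) p 0"

lemma op_poly_0 [simp]: "op_poly T 0 = 0"
  by (simp add: op_poly_def)

text \<open>Horner recursion. \<open>fold_coeffs\<close> ignores trailing zeros, so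
  \<open>pCons 0 0\<close> is treated apart; there both sides vanish.\<close>

lemma op_poly_pCons [simp]: "op_poly T (pCons a p) = a *\<^sub>R id_blinfun + (T o\<^sub>L op_poly T p)"
  by (cases "a = 0 \<and> p = 0") (auto simp: op_poly_def)

lemma op_poly_1 [simp]: "op_poly T 1 = id_blinfun"
  by (simp add: one_pCons)

lemma op_poly_add: "op_poly T (p + q) = op_poly T p + op_poly T q"
  by (induction p q rule: poly_induct2) (simp_all add: op_bilinear algebra_simps)

lemma op_poly_smult: "op_poly T (smult c p) = c *\<^sub>R op_poly T p"
  by (induction p) (simp_all add: op_bilinear algebra_simps)

lemma op_poly_diff: "op_poly T (p - q) = op_poly T p - op_poly T q"
  using op_poly_add[of T p "smult (-1) q"] op_poly_smult[of T "-1" q] by simp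

lemma op_poly_sum: "op_poly T (\<Sum>k\<in>I. p k) = (\<Sum>k\<in>I. op_poly T (p k))"
  by (induction I rule: infinite_finite_induct) (auto simp: op_poly_add)

lemma op_poly_mult: "op_poly T (p * q) = op_poly T p o\<^sub>L op_poly T q"
  by (induction p) (simp_all add: op_poly_add op_poly_smult op_bilinear op_compose_assoc)

lemma op_poly_commute: "op_poly T p o\<^sub>L op_poly T q = op_poly T q o\<^sub>L op_poly T p"
  by (metis mult.commute op_poly_mult)

lemma selfadj_op_poly: "selfadj T \<Longrightarrow> selfadj (op_poly T p)"
proof (induction p)
  case (pCons a p)
  have "T o\<^sub>L op_poly T p = op_poly T p o\<^sub>L T"
    using op_poly_commute[of T "[:0, 1:]" p] by simp
  then show ?case using pCons by (simp add: selfadj_add selfadj_scaleR selfadj_compose)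
qed simp

text \<open>Bernstein coefficients are kept separate from the degree: multiplication by the variable turns
  \<^term>\<open>bernstein m (\<lambda>k. c (Suc k))\<close> into a Bernstein form of degree \<^term>\<open>Suc m\<close>.\<close>

definition bernstein :: "nat \<Rightarrow> (nat \<Rightarrow> real) \<Rightarrow> real poly" where
  "bernstein n c = (\<Sum>k\<le>n. smult (c k * real (n choose k)) ([:0, 1:] ^ k * [:1, -1:] ^ (n - k)))"

lemma poly_bernstein: "poly (bernstein n c) x = (\<Sum>k\<le>n. c k * Bernstein n k x)"
  by (simp add: bernstein_def poly_sum Bernstein_def algebra_simps)

lemma bernstein_const: "bernstein n (\<lambda>_. a) = [:a:]"
  by (simp add: fun_eq_iff poly_bernstein sum_distrib_left[symmetric] flip: poly_eq_poly_eq_iff)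

lemma bernstein_diff: "bernstein n (\<lambda>k. c k - d k) = bernstein n c - bernstein n d"
  by (simp add: bernstein_def left_diff_distrib smult_diff_left sum_subtractf)

lemma bernstein_add: "bernstein n (\<lambda>k. c k + d k) = bernstein n c + bernstein n d"
  by (simp add: bernstein_def distrib_right smult_add_left sum.distrib)

text \<open>The weight \<open>k / (m + 1)\<close> kills the term \<open>k = 0\<close> and is
  otherwise absorbed by the identity
  \<open>(k + 1) * (m + 1 choose k + 1) = (m + 1) * (m choose k)\<close>.\<close>

lemma bernstein_Suc_mult:
  "bernstein (Suc m) (\<lambda>k. real k / real (Suc m) * c k) = [:0, 1:] * bernstein m (\<lambda>k. c (Suc k))"
proof -
  have "real (Suc k) / real (Suc m) * c (Suc k) * real (Suc m choose Suc k)
      = c (Suc k) * real (m choose k)" for k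
  proof -
    have "real (Suc k) * real (Suc m choose Suc k) = real (Suc m) * real (m choose k)"
      using Suc_times_binomial_eq[of m k] by (metis mult.commute of_nat_mult)
    then show ?thesis by (simp add: field_simps del: of_nat_Suc binomial_Suc_Suc)
  qed
  then show ?thesis
    unfolding bernstein_def
    by (subst sum.atMost_Suc_shift)
       (simp add: sum_distrib_left mult.assoc[symmetric] del: of_nat_Suc binomial_Suc_Suc)
qed

text \<open>Order form of the condition that the spectrum lies in the unit interval, where Bernstein
  polynomials approximate.\<close>

locale pos_contraction =
  fixes T :: "('a::{real_inner, complete_space}) op"
  assumes pos_T: "positive_op T" and pos_compl: "positive_op (id_blinfun - T)"
begin

lemma selfadj_T: "selfadj T"
  using pos_T by (simp add: positive_op_def)

text \<open>Up to squares only the exponents 0 and 1 matter, and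
  \<open>T (1 - T) = T (1 - T) T + (1 - T) T (1 - T)\<close>.\<close>

lemma positive_op_monomial: "positive_op (op_poly T ([:0, 1:] ^ i * [:1, -1:] ^ j))"
proof -
  let ?x = "[:0, 1:] :: real poly" and ?y = "[:1, -1:] :: real poly"
  have sq: "positive_op (op_poly T (r * q * r))" if "positive_op (op_poly T q)" for r q
    using that selfadj_op_poly[OF selfadj_T] by (simp add: op_poly_mult positive_op_sandwich)
  have x: "positive_op (op_poly T ?x)" and y: "positive_op (op_poly T ?y)"
    using pos_T pos_compl by (simp_all add: op_bilinear)
  have eq: "?x * ?y = ?x * ?y * ?x + ?y * ?x * ?y" by (simp add: algebra_simps)
  have xy: "positive_op (op_poly T (?x * ?y))"
    by (subst eq, subst op_poly_add) (intro positive_op_add sq x y)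
  have "positive_op (op_poly T (?x ^ (i mod 2) * ?y ^ (j mod 2)))"
    using x y xy by (cases "even i"; cases "even j") (auto simp: even_iff_mod_2_eq_zero odd_iff_mod_2_eq_one)
  from sq[OF this, of "?x ^ (i div 2) * ?y ^ (j div 2)"]
  have "positive_op (op_poly T ((?x ^ (i div 2) * ?x ^ (i mod 2) * ?x ^ (i div 2)) *
      (?y ^ (j div 2) * ?y ^ (j mod 2) * ?y ^ (j div 2))))"
    by (simp only: ac_simps)
  moreover have "p ^ (n div 2) * p ^ (n mod 2) * p ^ (n div 2) = p ^ n" for p :: "real poly" and n
  proof -
    have "n div 2 + n mod 2 + n div 2 = n" by presburger
    then show ?thesis by (simp only: power_add[symmetric])
  qed
  ultimately show ?thesis by simp
qed

lemma positive_op_bernstein: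
  "(\<And>k. k \<le> n \<Longrightarrow> 0 \<le> c k) \<Longrightarrow> positive_op (op_poly T (bernstein n c))"
  unfolding bernstein_def op_poly_sum op_poly_smult
  by (intro positive_op_sum positive_op_scaleR positive_op_monomial) auto

text \<open>The Bernstein forms with coefficients \<open>M - c k\<close> and \<open>M + c k\<close>
  are positive, and the constant \<open>M\<close> has Bernstein form \<open>M\<close>. The bound is
  in terms of the coefficients, not yet of the values of the polynomial.\<close>

lemma norm_bernstein:
  assumes "\<And>k. k \<le> n \<Longrightarrow> \<bar>c k\<bar> \<le> M"
  shows "norm (op_poly T (bernstein n c)) \<le> M"
proof (rule norm_op_le)
  have "positive_op (op_poly T (bernstein n (\<lambda>k. M - c k)))"
    "positive_op (op_poly T (bernstein n (\<lambda>k. M + c k)))"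
    using assms by (fastforce intro!: positive_op_bernstein simp: abs_le_iff)+
  then show "positive_op (M *\<^sub>R id_blinfun - op_poly T (bernstein n c))"
    "positive_op (M *\<^sub>R id_blinfun + op_poly T (bernstein n c))"
    by (simp_all add: bernstein_diff bernstein_add bernstein_const op_poly_add op_poly_diff)
  show "0 \<le> M" using assms[of 0] by simp
qed

text \<open>Convergence is in operator norm, and the sup-norm bound is only derived from it, so the
  proof is an induction on \<open>p\<close> instead of an appeal to Weierstrass. Multiplication by
  the variable turns samples at \<open>(k + 1) / (m + 1)\<close> in degree \<open>m\<close> into
  samples at \<open>k / (m + 1)\<close> in degree \<open>m + 1\<close>; uniform continuity makes the
  shift of nodes negligible.\<close>

lemma bernstein_LIMSEQ:
  "(\<lambda>n. op_poly T (bernstein n (\<lambda>k. poly p (real k / real n)))) \<longlonglongrightarrow> op_poly T p"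
proof (induction p)
  case 0
  then show ?case by (simp add: bernstein_const)
next
  case (pCons a p)
  define E where "E m = op_poly T (bernstein m (\<lambda>k. poly p (real (Suc k) / real (Suc m))))" for m
  have "(\<lambda>m. E m - op_poly T (bernstein m (\<lambda>k. poly p (real k / real m)))) \<longlonglongrightarrow> 0"
  proof (rule LIMSEQ_I)
    fix e :: real assume "0 < e"
    have "uniformly_continuous_on {0..1} (poly p)"
      by (intro compact_uniformly_continuous) (auto intro!: continuous_intros)
    with \<open>0 < e\<close> obtain d where "d > 0" and
      d: "\<And>x y. x \<in> {0..1} \<Longrightarrow> y \<in> {0..1} \<Longrightarrow> dist y x < d \<Longrightarrow> dist (poly p y) (poly p x) < e / 2"
      unfolding uniformly_continuous_on_def by (meson half_gt_zero)
    obtain N where N: "1 / real (Suc N) < d"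
      using \<open>d > 0\<close> by (metis inverse_eq_divide reals_Archimedean)
    have "norm (E m - op_poly T (bernstein m (\<lambda>k. poly p (real k / real m))) - 0) < e"
      if "m \<ge> Suc N" for m
    proof -
      have "norm (op_poly T (bernstein m (\<lambda>k. poly p (real (Suc k) / real (Suc m)) - poly p (real k / real m)))) \<le> e / 2"
      proof (rule norm_bernstein)
        fix k assume "k \<le> m"
        have m: "real m > 0" using that by simp
        \<comment> \<open>The shifted and unshifted nodes differ by at most
          \<open>1 / (m + 1)\<close>.\<close>
        have "real (Suc k) / real (Suc m) - real k / real m = (real m - real k) / (real m * real (Suc m))"
          using m by (simp add: field_simps)
        moreover have "0 \<le> (real m - real k) / (real m * real (Suc m))"
          using \<open>k \<le> m\<close> m by (intro divide_nonneg_nonneg) auto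
        moreover have "(real m - real k) / (real m * real (Suc m)) \<le> 1 / real (Suc m)"
        proof -
          have "(real m - real k) / (real m * real (Suc m)) \<le> real m / (real m * real (Suc m))"
            by (intro divide_right_mono) auto
          then show ?thesis using m by simp
        qed
        moreover have "1 / real (Suc m) \<le> 1 / real (Suc N)"
          using that by (simp add: frac_le)
        ultimately have "dist (real (Suc k) / real (Suc m)) (real k / real m) < d"
          using N unfolding dist_real_def by linarith
        moreover have "real (Suc k) / real (Suc m) \<in> {0..1}" "real k / real m \<in> {0..1}"
          using \<open>k \<le> m\<close> m by (simp_all add: divide_le_eq)
        ultimately show "\<bar>poly p (real (Suc k) / real (Suc m)) - poly p (real k / real m)\<bar> \<le> e / 2"
          using d[of "real k / real m" "real (Suc k) / real (Suc m)"]
          by (simp only: dist_real_def less_imp_le)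
      qed
      then show ?thesis using \<open>0 < e\<close> by (simp only: E_def bernstein_diff op_poly_diff diff_zero)
    qed
    then show "\<exists>N. \<forall>m\<ge>N. norm (E m - op_poly T (bernstein m (\<lambda>k. poly p (real k / real m))) - 0) < e"
      by blast
  qed
  from tendsto_add[OF this pCons.IH] have "E \<longlonglongrightarrow> op_poly T p" by simp
  then have "(\<lambda>m. a *\<^sub>R id_blinfun + (T o\<^sub>L E m)) \<longlonglongrightarrow> op_poly T (pCons a p)"
    by (auto intro!: tendsto_intros bounded_bilinear.tendsto[OF bounded_bilinear_blinfun_compose])
  moreover have "a *\<^sub>R id_blinfun + (T o\<^sub>L E m) =
      op_poly T (bernstein (Suc m) (\<lambda>k. poly (pCons a p) (real k / real (Suc m))))" for m
    using bernstein_Suc_mult[of m "\<lambda>k. poly p (real k / real (Suc m))"]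
    by (simp only: E_def poly_pCons bernstein_add bernstein_const op_poly_add op_poly_mult)
       (simp add: op_poly_mult)
  ultimately show ?case
    \<comment> \<open>The identity just shown describes degree \<open>Suc m\<close> only, hence the
      index shift.\<close>
    by (subst filterlim_sequentially_Suc[symmetric]) simp
qed

text \<open>The samples \<open>poly p (k / n)\<close> are bounded by \<open>M\<close>, so
  \<open>norm_bernstein\<close> applies for every \<open>n\<close> and passes to the limit. At
  \<open>n = 0\<close> the quotient is \<open>0\<close>, still in the unit interval.\<close>

lemma op_poly_norm:
  assumes "\<And>x. x \<in> {0..1} \<Longrightarrow> \<bar>poly p x\<bar> \<le> M"
  shows "norm (op_poly T p) \<le> M"
proof (rule LIMSEQ_le_const2[OF tendsto_norm[OF bernstein_LIMSEQ]], intro exI allI impI)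
  show "norm (op_poly T (bernstein n (\<lambda>k. poly p (real k / real n)))) \<le> M" for n
    by (rule norm_bernstein, rule assms) (auto simp: divide_le_eq)
qed

end

section \<open>Continuous functional calculus\<close>

text \<open>Only samples of \<open>f\<close> in the unit interval enter, so
  \<open>opfun_cong\<close> holds without continuity; convergence is proved for continuous
  \<open>f\<close> in \<open>pos_contraction\<close>.\<close>

definition opfun :: "('a::{real_normed_vector, complete_space}) op \<Rightarrow> (real \<Rightarrow> real) \<Rightarrow> 'a op" where
  "opfun T f = lim (\<lambda>n. op_poly T (bernstein n (\<lambda>k. f (real k / real n))))"

lemma uniform_limit_bernstein:
  assumes "continuous_on {0..1} f"
  shows "uniform_limit {0..1} (\<lambda>n. poly (bernstein n (\<lambda>k. f (real k / real n)))) f sequentially"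
proof (rule uniform_limitI)
  fix e :: real assume "0 < e"
  from Bernstein_Weierstrass[OF assms this] obtain N where
    "\<And>n x. N \<le> n \<Longrightarrow> 0 \<le> x \<Longrightarrow> x \<le> 1 \<Longrightarrow> \<bar>f x - (\<Sum>k\<le>n. f (real k / real n) * Bernstein n k x)\<bar> < e"
    by (metis atLeastAtMost_iff)
  then show "\<forall>\<^sub>F n in sequentially. \<forall>x\<in>{0..1}. dist (poly (bernstein n (\<lambda>k. f (real k / real n))) x) (f x) < e"
    by (auto simp: eventually_sequentially poly_bernstein dist_real_def abs_minus_commute intro!: exI[of _ N])
qed

lemma opfun_cong: "(\<And>x. x \<in> {0..1} \<Longrightarrow> f x = g x) \<Longrightarrow> opfun T f = opfun T g"
  unfolding opfun_def bernstein_def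
  by (intro arg_cong[of _ _ lim] ext arg_cong[of _ _ "op_poly T"] sum.cong) (auto simp: divide_le_eq)

context pos_contraction
begin

text \<open>Taking \<open>p = q\<close> gives the Cauchy property; two different sequences give
  independence of the limit from the approximation.\<close>

lemma op_poly_uniform_Cauchy:
  assumes p: "uniform_limit {0..1} (\<lambda>n. poly (p n)) f sequentially"
    and q: "uniform_limit {0..1} (\<lambda>n. poly (q n)) f sequentially" and "0 < e"
  shows "\<exists>N. \<forall>m\<ge>N. \<forall>n\<ge>N. norm (op_poly T (p m) - op_poly T (q n)) < e"
proof -
  have "\<forall>\<^sub>F n in sequentially. \<forall>x\<in>{0..1}. dist (poly (p n) x) (f x) < e / 4"
    "\<forall>\<^sub>F n in sequentially. \<forall>x\<in>{0..1}. dist (poly (q n) x) (f x) < e / 4"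
    using p q \<open>0 < e\<close> unfolding uniform_limit_iff by (meson zero_less_divide_iff zero_less_numeral)+
  then obtain N where N: "\<And>n x. n \<ge> N \<Longrightarrow> x \<in> {0..1} \<Longrightarrow> \<bar>poly (p n) x - f x\<bar> < e / 4 \<and> \<bar>poly (q n) x - f x\<bar> < e / 4"
    unfolding eventually_sequentially dist_real_def by (metis le_trans nle_le)
  have "norm (op_poly T (p m - q n)) \<le> e / 2" if "m \<ge> N" "n \<ge> N" for m n
  proof (rule op_poly_norm)
    show "\<bar>poly (p m - q n) x\<bar> \<le> e / 2" if "x \<in> {0..1}" for x
      using N[OF \<open>m \<ge> N\<close> that] N[OF \<open>n \<ge> N\<close> that] by (simp add: abs_if split: if_splits)
  qed
  then show ?thesis using \<open>0 < e\<close> by (intro exI[of _ N]) (fastforce simp: op_poly_diff)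
qed

lemma opfun_LIMSEQ_bernstein:
  assumes "continuous_on {0..1} f"
  shows "(\<lambda>n. op_poly T (bernstein n (\<lambda>k. f (real k / real n)))) \<longlonglongrightarrow> opfun T f"
proof -
  note u = uniform_limit_bernstein[OF assms]
  have "Cauchy (\<lambda>n. op_poly T (bernstein n (\<lambda>k. f (real k / real n))))"
    using op_poly_uniform_Cauchy[OF u u] by (intro CauchyI) blast
  then show ?thesis
    unfolding opfun_def by (intro convergent_LIMSEQ_iff[THEN iffD1] Cauchy_convergent)
qed

text \<open>Arbitrary polynomial approximations are needed for products, since a product of
  Bernstein forms is not the Bernstein form of the product.\<close>

lemma opfun_LIMSEQ:
  assumes "continuous_on {0..1} f" "uniform_limit {0..1} (\<lambda>n. poly (p n)) f sequentially"
  shows "(\<lambda>n. op_poly T (p n)) \<longlonglongrightarrow> opfun T f"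
proof -
  let ?b = "\<lambda>n. bernstein n (\<lambda>k. f (real k / real n))"
  have "(\<lambda>n. op_poly T (p n) - op_poly T (?b n)) \<longlonglongrightarrow> 0"
    using op_poly_uniform_Cauchy[OF assms(2) uniform_limit_bernstein[OF assms(1)]]
    by (intro LIMSEQ_I) (metis diff_zero)
  from tendsto_add[OF this opfun_LIMSEQ_bernstein[OF assms(1)]] show ?thesis by simp
qed

lemma opfun_poly: "opfun T (poly p) = op_poly T p"
proof -
  have "(\<lambda>n. op_poly T p) \<longlonglongrightarrow> opfun T (poly p)"
    by (rule opfun_LIMSEQ) (auto intro!: continuous_intros uniform_limitI)
  then show ?thesis by (simp add: LIMSEQ_const_iff)
qed

lemma opfun_const: "opfun T (\<lambda>_. a) = a *\<^sub>R id_blinfun"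
proof -
  have "poly [:a:] = (\<lambda>_. a)" by (simp add: fun_eq_iff)
  then show ?thesis using opfun_poly[of "[:a:]"] by simp
qed

lemma opfun_ident: "opfun T (\<lambda>x. x) = T"
  using opfun_poly[of "[:0, 1:]"] by (simp cong: opfun_cong)

lemma opfun_add:
  assumes "continuous_on {0..1} f" "continuous_on {0..1} g"
  shows "opfun T (\<lambda>x. f x + g x) = opfun T f + opfun T g"
proof -
  have "(\<lambda>n. op_poly T (bernstein n (\<lambda>k. f (real k / real n) + g (real k / real n)))) \<longlonglongrightarrow> opfun T f + opfun T g"
    using assms unfolding bernstein_add op_poly_add by (intro tendsto_add opfun_LIMSEQ_bernstein)
  then show ?thesis
    using opfun_LIMSEQ_bernstein[of "\<lambda>x. f x + g x"] assms LIMSEQ_unique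
    by (blast intro: continuous_on_add)
qed

lemma opfun_mult:
  assumes "continuous_on {0..1} f" "continuous_on {0..1} g"
  shows "opfun T (\<lambda>x. f x * g x) = opfun T f o\<^sub>L opfun T g"
proof -
  let ?b = "\<lambda>f n. bernstein n (\<lambda>k. f (real k / real n))"
  \<comment> \<open>Uniform limits multiply when the limit functions are bounded.\<close>
  have "bounded (f ` {0..1})" "bounded (g ` {0..1})"
    using assms by (auto intro!: compact_imp_bounded compact_continuous_image)
  then have "uniform_limit {0..1} (\<lambda>n. poly (?b f n * ?b g n)) (\<lambda>x. f x * g x) sequentially"
    unfolding poly_mult by (intro uniform_lim_mult uniform_limit_bernstein assms)
  from opfun_LIMSEQ[OF continuous_on_mult[OF assms] this]
  have "(\<lambda>n. op_poly T (?b f n) o\<^sub>L op_poly T (?b g n)) \<longlonglongrightarrow> opfun T (\<lambda>x. f x * g x)"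
    by (simp add: op_poly_mult)
  then show ?thesis
    using bounded_bilinear.tendsto[OF bounded_bilinear_blinfun_compose
        opfun_LIMSEQ_bernstein[OF assms(1)] opfun_LIMSEQ_bernstein[OF assms(2)]]
    by (rule LIMSEQ_unique)
qed

lemma opfun_scaleR:
  assumes "continuous_on {0..1} f"
  shows "opfun T (\<lambda>x. c * f x) = c *\<^sub>R opfun T f"
  using opfun_mult[OF continuous_on_const[of _ c] assms] by (simp add: opfun_const op_bilinear)

lemma opfun_diff:
  assumes "continuous_on {0..1} f" "continuous_on {0..1} g"
  shows "opfun T (\<lambda>x. f x - g x) = opfun T f - opfun T g"
  using opfun_add[OF assms(1) continuous_on_mult[OF continuous_on_const assms(2)], of "-1"]
    opfun_scaleR[OF assms(2), of "-1"] by simp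

lemma opfun_positive:
  assumes "continuous_on {0..1} f" "\<And>x. x \<in> {0..1} \<Longrightarrow> 0 \<le> f x"
  shows "positive_op (opfun T f)"
  by (rule positive_op_LIMSEQ[OF opfun_LIMSEQ_bernstein[OF assms(1)]], rule positive_op_bernstein, rule assms(2))
     (auto simp: divide_le_eq)

lemma selfadj_opfun: "continuous_on {0..1} f \<Longrightarrow> selfadj (opfun T f)"
  by (rule selfadj_LIMSEQ[OF opfun_LIMSEQ_bernstein]) (auto intro: selfadj_op_poly selfadj_T)

lemma opfun_norm:
  assumes "continuous_on {0..1} f" "\<And>x. x \<in> {0..1} \<Longrightarrow> \<bar>f x\<bar> \<le> M"
  shows "norm (opfun T f) \<le> M"
proof (rule LIMSEQ_le_const2[OF tendsto_norm[OF opfun_LIMSEQ_bernstein[OF assms(1)]]], intro exI allI impI)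
  show "norm (op_poly T (bernstein n (\<lambda>k. f (real k / real n)))) \<le> M" for n
    by (rule norm_bernstein, rule assms(2)) (auto simp: divide_le_eq)
qed

lemma opfun_uniform_limit:
  assumes "\<And>n. continuous_on {0..1} (f n)" "continuous_on {0..1} g"
    "uniform_limit {0..1} f g sequentially"
  shows "(\<lambda>n. opfun T (f n)) \<longlonglongrightarrow> opfun T g"
proof (rule LIMSEQ_I)
  fix e :: real assume "0 < e"
  then have "\<forall>\<^sub>F n in sequentially. \<forall>x\<in>{0..1}. dist (f n x) (g x) < e / 2"
    using assms(3) unfolding uniform_limit_iff by (meson half_gt_zero)
  then obtain N where N: "\<And>n x. n \<ge> N \<Longrightarrow> x \<in> {0..1} \<Longrightarrow> \<bar>f n x - g x\<bar> < e / 2"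
    unfolding eventually_sequentially dist_real_def by blast
  have "norm (opfun T (f n) - opfun T g) \<le> e / 2" if "n \<ge> N" for n
    unfolding opfun_diff[OF assms(1,2), symmetric]
    using N[OF that] by (intro opfun_norm continuous_on_diff assms) (auto intro: less_imp_le)
  then show "\<exists>N. \<forall>n\<ge>N. norm (opfun T (f n) - opfun T g) < e"
    using \<open>0 < e\<close> by (intro exI[of _ N]) fastforce
qed

section \<open>Power series in the calculus: exponential, logarithm and real powers\<close>

lemma opow_opfun:
  assumes "continuous_on {0..1} f"
  shows "opow (opfun T f) k = opfun T (\<lambda>x. f x ^ k)"
  by (induction k) (simp_all add: opfun_const opow_Suc opfun_mult assms continuous_on_power)

lemma opfun_sum:
  assumes "\<And>k. k \<in> I \<Longrightarrow> continuous_on {0..1} (f k)"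
  shows "opfun T (\<lambda>x. \<Sum>k\<in>I. f k x) = (\<Sum>k\<in>I. opfun T (f k))"
  using assms by (induction I rule: infinite_finite_induct) (auto simp: opfun_const opfun_add continuous_on_sum)

text \<open>The Weierstrass M-test gives uniform convergence of the scalar series. The exponent map
  \<open>e\<close> covers both the exponential series (\<open>k\<close>) and the logarithm series
  (\<open>Suc k\<close>).\<close>

lemma opfun_power_series:
  assumes f: "continuous_on {0..1} f" "\<And>x. x \<in> {0..1} \<Longrightarrow> \<bar>f x\<bar> \<le> r"
    and c: "summable (\<lambda>k. \<bar>c k\<bar> * r ^ e k)"
  shows "(\<lambda>k. c k *\<^sub>R opow (opfun T f) (e k)) sums opfun T (\<lambda>x. \<Sum>k. c k * f x ^ e k)"
proof -
  have u: "uniform_limit {0..1} (\<lambda>n x. \<Sum>k<n. c k * f x ^ e k) (\<lambda>x. \<Sum>k. c k * f x ^ e k) sequentially"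
    using f(2) by (intro Weierstrass_m_test[OF _ c]) (auto simp: abs_mult power_abs intro!: mult_left_mono power_mono)
  have cont: "continuous_on {0..1} (\<lambda>x. \<Sum>k<n. c k * f x ^ e k)" for n
    by (intro continuous_intros f)
  have "continuous_on {0..1} (\<lambda>x. \<Sum>k. c k * f x ^ e k)"
    by (rule uniform_limit_theorem[OF _ u]) (use cont in auto)
  from opfun_uniform_limit[OF cont this u]
  have "(\<lambda>n. opfun T (\<lambda>x. \<Sum>k<n. c k * f x ^ e k)) \<longlonglongrightarrow> opfun T (\<lambda>x. \<Sum>k. c k * f x ^ e k)" .
  moreover have "opfun T (\<lambda>x. \<Sum>k<n. c k * f x ^ e k) = (\<Sum>k<n. c k *\<^sub>R opow (opfun T f) (e k))" for n
    by (subst opfun_sum) (auto intro!: continuous_intros f(1) simp: opow_opfun[OF f(1)] opfun_scaleR continuous_on_power[OF f(1)])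
  ultimately show ?thesis by (simp add: sums_def)
qed

lemma op_exp_opfun:
  assumes f: "continuous_on {0..1} f"
  shows "op_exp (opfun T f) = opfun T (\<lambda>x. exp (f x))"
proof -
  obtain r where r: "\<And>x. x \<in> {0..1} \<Longrightarrow> \<bar>f x\<bar> \<le> r"
    using compact_imp_bounded[OF compact_continuous_image[OF f compact_Icc]]
    unfolding bounded_iff by (metis imageI real_norm_def)
  have "summable (\<lambda>k. \<bar>1 / fact k\<bar> * r ^ k)"
    using summable_exp[of r] by (simp add: divide_inverse)
  from sums_unique[OF opfun_power_series[OF f r this]] show ?thesis
    by (simp add: op_exp_def exp_def divide_inverse)
qed

text \<open>For \<open>h = max (f - c) 0\<close> one has \<open>h\<^sup>3 = h (f - c) h\<close>, which is both positive and negative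
  under the calculus.\<close>

lemma opfun_excess_eq_0:
  assumes f: "continuous_on {0..1} f" and c: "positive_op (c *\<^sub>R id_blinfun - opfun T f)"
  shows "opfun T (\<lambda>x. max (f x - c) 0) = 0"
proof -
  define h where "h x = max (f x - c) 0" for x
  have h: "continuous_on {0..1} h" unfolding h_def by (intro continuous_intros f)
  let ?H = "opfun T h"
  note cont = continuous_intros h f
  have sa: "inner (?H x) y = inner x (?H y)" for x y using selfadj_opfun[OF h] by (simp add: selfadj_def)
  have "?H o\<^sub>L (c *\<^sub>R id_blinfun - opfun T f) o\<^sub>L ?H = opfun T (\<lambda>x. h x * (c - f x) * h x)"
    by (simp add: opfun_mult opfun_diff opfun_const cont)
  also have "\<dots> = opfun T (\<lambda>x. - 1 * (h x * h x * h x))"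
    by (rule opfun_cong) (auto simp: h_def max_def algebra_simps)
  also have "\<dots> = - opfun T (\<lambda>x. h x * h x * h x)"
    by (subst opfun_scaleR) (auto intro!: cont)
  finally have "positive_op (- opfun T (\<lambda>x. h x * h x * h x))"
    using positive_op_sandwich[OF selfadj_opfun[OF h] c] by simp
  moreover have "positive_op (opfun T (\<lambda>x. h x * h x * h x))"
    by (rule opfun_positive) (auto intro!: cont simp: h_def)
  ultimately have "positive_op (0 *\<^sub>R id_blinfun - opfun T (\<lambda>x. h x * h x * h x))"
     "positive_op (0 *\<^sub>R id_blinfun + opfun T (\<lambda>x. h x * h x * h x))" by auto
  from norm_op_le[OF this] have "?H o\<^sub>L ?H o\<^sub>L ?H = 0"
    by (simp add: opfun_mult cont)
  then have H3: "?H (?H (?H x)) = 0" for x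
    by (metis blinfun_apply_blinfun_compose zero_blinfun.rep_eq)
  \<comment> \<open>Symmetry lowers the power: the squared norm of \<open>?H (?H x)\<close> is the
    inner product of \<open>?H x\<close> with \<open>?H (?H (?H x))\<close>.\<close>
  have H2: "?H (?H x) = 0" for x
    using sa[of "?H x" "?H (?H x)"] H3 by (metis inner_eq_zero_iff inner_zero_right)
  have "?H x = 0" for x
    using sa[of x "?H x"] H2 by (metis inner_eq_zero_iff inner_zero_right)
  then have "?H = 0" by (intro blinfun_eqI) simp
  then show ?thesis by (simp add: h_def[abs_def])
qed

text \<open>The series for \<^const>\<open>op_ln\<close> is scaled by the norm of the operator, which \<open>f\<close> may exceed outside the
  spectrum; truncating \<open>f\<close> at that scale does not change \<open>opfun T f\<close>.\<close>

lemma op_ln_opfun: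
  assumes f: "continuous_on {0..1} f" and pos: "\<And>x. x \<in> {0..1} \<Longrightarrow> 0 < f x"
  shows "op_ln (opfun T f) = opfun T (\<lambda>x. ln (f x))"
proof -
  define c where "c = norm (opfun T f) + 1"
  have "c \<ge> 1" by (simp add: c_def)
  define g where "g x = min (f x) c" for x
  have g: "continuous_on {0..1} g" unfolding g_def by (intro continuous_intros f)
  have gpos: "x \<in> {0..1} \<Longrightarrow> 0 < g x" for x using pos \<open>c \<ge> 1\<close> by (simp add: g_def)
  have "positive_op (c *\<^sub>R id_blinfun - opfun T f)"
    by (rule positive_op_norm_diff[OF selfadj_opfun[OF f]]) (simp add: c_def)
  from opfun_excess_eq_0[OF f this] have ex: "opfun T (\<lambda>x. max (f x - c) 0) = 0" .
  have fg: "opfun T f = opfun T g"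
  proof -
    have "opfun T (\<lambda>x. f x - g x) = opfun T (\<lambda>x. max (f x - c) 0)"
      by (rule opfun_cong) (auto simp: g_def)
    then show ?thesis using opfun_diff[OF f g] ex by simp
  qed
  have lf: "continuous_on {0..1} (\<lambda>x. ln (f x))" and lg: "continuous_on {0..1} (\<lambda>x. ln (g x))"
    by (intro continuous_on_ln f g ballI; use pos gpos in force)+
  have lnfg: "opfun T (\<lambda>x. ln (f x)) = opfun T (\<lambda>x. ln (g x))"
  proof -
    \<comment> \<open>\<open>?u\<close> lies between \<open>0\<close> and the excess
      \<open>max (f x - c) 0\<close>, which the calculus sends to \<open>0\<close>; so
      \<open>opfun T ?u\<close> vanishes too.\<close>
    let ?u = "\<lambda>x. ln (f x) - ln (g x)"
    have h: "continuous_on {0..1} (\<lambda>x. max (f x - c) 0)" by (intro continuous_intros f)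
    have p1: "positive_op (opfun T ?u)"
    proof (rule opfun_positive[OF continuous_on_diff[OF lf lg]])
      show "0 \<le> ?u x" if "x \<in> {0..1}" for x
        using gpos[OF that] by (simp add: g_def)
    qed
    have le: "?u x \<le> max (f x - c) 0" if "x \<in> {0..1}" for x
    proof (cases "f x \<le> c")
      case False
      then have "?u x = ln (f x / c)" using \<open>c \<ge> 1\<close> pos[OF that] by (simp add: g_def ln_div)
      also have "\<dots> \<le> f x / c - 1" using \<open>c \<ge> 1\<close> pos[OF that] by (intro ln_le_minus_one) auto
      also have "\<dots> = (f x - c) / c" using \<open>c \<ge> 1\<close> by (simp add: field_simps)
      also have "\<dots> \<le> f x - c" using False \<open>c \<ge> 1\<close> by (simp add: divide_le_eq mult_le_cancel_left1)
      finally show ?thesis by simp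
    qed (simp add: g_def)
    have "positive_op (opfun T (\<lambda>x. max (f x - c) 0 - ?u x))"
      by (rule opfun_positive) (use le in \<open>auto intro!: continuous_on_diff h lf lg\<close>)
    then have "positive_op (0 *\<^sub>R id_blinfun - opfun T ?u)"
      by (simp add: opfun_diff[OF h continuous_on_diff[OF lf lg]] ex)
    from norm_op_le[OF this] p1 have "opfun T ?u = 0" by simp
    then show ?thesis by (simp add: opfun_diff lf lg)
  qed
  obtain d where d: "d > 0" "\<And>x. x \<in> {0..1} \<Longrightarrow> d \<le> g x"
  proof -
    obtain y where "y \<in> {0..1}" "\<forall>x\<in>{0..1}. g y \<le> g x"
      using continuous_attains_inf[OF compact_Icc _ g] by auto
    then show ?thesis using that gpos by blast
  qed
  have "d \<le> c" using d(2)[of 0] by (simp add: g_def)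
  \<comment> \<open>A positive lower bound \<open>d\<close> of \<open>g\<close> keeps
    \<open>w\<close> within radius \<open>r < 1\<close>, where the logarithm series converges
    uniformly.\<close>
  define r where "r = 1 - d / c"
  have r: "0 \<le> r" "r < 1" using d(1) \<open>c \<ge> 1\<close> \<open>d \<le> c\<close> by (simp_all add: r_def divide_le_eq)
  define w where "w x = 1 - g x / c" for x
  have w: "continuous_on {0..1} w" unfolding w_def using \<open>c \<ge> 1\<close> by (intro continuous_intros g) auto
  have wr: "\<bar>w x\<bar> \<le> r" if "x \<in> {0..1}" for x
    using d(2)[OF that] \<open>c \<ge> 1\<close> by (simp add: w_def r_def g_def divide_right_mono divide_le_eq)
  have ow: "id_blinfun - (1 / c) *\<^sub>R opfun T f = opfun T w"
    unfolding w_def fg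
    using opfun_diff[OF continuous_on_const continuous_on_mult[OF continuous_on_const g], of 1 "1 / c"]
      opfun_scaleR[OF g, of "1 / c"] by (simp add: opfun_const)
  have "summable (\<lambda>k. \<bar>1 / real (Suc k)\<bar> * r ^ Suc k)"
  proof (rule summable_comparison_test')
    show "summable (\<lambda>k. r ^ Suc k)" using r by (subst summable_Suc_iff) (simp add: summable_geometric)
    show "norm (\<bar>1 / real (Suc k)\<bar> * r ^ Suc k) \<le> r ^ Suc k" for k
    proof -
      have "r ^ Suc k / real (Suc k) \<le> r ^ Suc k / 1"
        using r by (intro divide_left_mono) auto
      then show ?thesis using r by simp
    qed
  qed
  from sums_unique[OF opfun_power_series[OF w wr this]]
  have "(\<Sum>k. (1 / real (Suc k)) *\<^sub>R opow (opfun T w) (Suc k)) = opfun T (\<lambda>x. \<Sum>k. 1 / real (Suc k) * w x ^ Suc k)"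
    by simp
  also have "\<dots> = opfun T (\<lambda>x. ln c - ln (g x))"
  proof (rule opfun_cong)
    fix x :: real assume x: "x \<in> {0..1}"
    have "(\<Sum>k. 1 / real (Suc k) * w x ^ Suc k) = - ln (1 - w x)"
    proof (rule sums_unique[symmetric])
      have "(\<lambda>k. - (w x ^ k) / real k) sums ln (1 - w x)"
        using ln_series'[of "- w x"] wr[OF x] r(2) by simp
      \<comment> \<open>The term at \<open>k = 0\<close> is a division by zero, hence
        \<open>0\<close>, so the shift leaves the sum unchanged.\<close>
      then have "(\<lambda>k. - (w x ^ Suc k) / real (Suc k)) sums ln (1 - w x)"
        by (subst sums_Suc_iff) simp
      from sums_minus[OF this]
      show "(\<lambda>k. 1 / real (Suc k) * w x ^ Suc k) sums (- ln (1 - w x))" by simp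
    qed
    also have "\<dots> = ln c - ln (g x)"
      using gpos[OF x] \<open>c \<ge> 1\<close> by (simp add: w_def ln_div)
    finally show "(\<Sum>k. 1 / real (Suc k) * w x ^ Suc k) = ln c - ln (g x)" .
  qed
  also have "\<dots> = ln c *\<^sub>R id_blinfun - opfun T (\<lambda>x. ln (g x))"
    by (simp add: opfun_diff lg opfun_const)
  finally show ?thesis
    by (simp add: op_ln_def Let_def c_def[symmetric] ow lnfg)
qed

lemma op_powr_opfun:
  assumes f: "continuous_on {0..1} f" and pos: "\<And>x. x \<in> {0..1} \<Longrightarrow> 0 < f x"
  shows "op_powr (opfun T f) t = opfun T (\<lambda>x. f x powr t)"
proof -
  have l: "continuous_on {0..1} (\<lambda>x. ln (f x))"
    using pos by (auto intro!: continuous_on_ln f simp: less_imp_neq[THEN not_sym])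
  have "op_powr (opfun T f) t = op_exp (t *\<^sub>R opfun T (\<lambda>x. ln (f x)))"
    by (simp only: op_powr_def op_ln_opfun[OF assms])
  also have "\<dots> = opfun T (\<lambda>x. exp (t * ln (f x)))"
    unfolding opfun_scaleR[OF l, symmetric]
    by (intro op_exp_opfun continuous_on_mult continuous_on_const l)
  also have "\<dots> = opfun T (\<lambda>x. f x powr t)"
    using pos by (intro opfun_cong) (force simp: powr_def)
  finally show ?thesis .
qed

end

section \<open>Scalar inequalities and integrability\<close>

text \<open>The left side is the integral of \<open>(f - F) * (g - c)\<close>, with \<open>F\<close>
  the mean of \<open>f\<close> and \<open>c\<close> the midpoint of \<open>a\<close> and
  \<open>b\<close>, so that \<open>\<bar>g t - c\<bar> \<le> (b - a) / 2\<close>. Bounding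
  \<open>\<bar>f t - F\<bar>\<close> by an affine function of \<open>f t\<close> leaves only
  integrals of \<open>f\<close>, \<open>g\<close> and their product.\<close>

lemma gruess_inequality:
  fixes f g :: "real \<Rightarrow> real"
  assumes f: "f integrable_on {0..1}" and g: "g integrable_on {0..1}"
    and gf: "(\<lambda>t. g t * f t) integrable_on {0..1}"
    and fb: "\<And>t. t \<in> {0..1} \<Longrightarrow> m \<le> f t \<and> f t \<le> M"
    and gb: "\<And>t. t \<in> {0..1} \<Longrightarrow> a \<le> g t \<and> g t \<le> b"
  shows "integral {0..1} (\<lambda>t. g t * f t) - integral {0..1} g * integral {0..1} f
      \<le> (M - m) * (b - a) / 4"
proof (cases "m = M")
  case True
  then have "integral {0..1} f = integral {0..1} (\<lambda>_::real. M)"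
    using fb by (intro integral_cong) force
  moreover have "integral {0..1} (\<lambda>t. g t * f t) = integral {0..1} (\<lambda>t. g t * M)"
    using fb True by (intro integral_cong) force
  ultimately show ?thesis using True by simp
next
  case False
  then have mM: "m < M" using fb[of 0] by simp
  have ab: "a \<le> b" using gb[of 0] by simp
  define F where "F = integral {0..1} f"
  define c where "c = (a + b) / 2"
  have "m \<le> F" "F \<le> M"
    using integral_le[of "\<lambda>_. m" "{0..1}" f] integral_le[of f "{0..1}" "\<lambda>_. M"] f fb
    by (auto simp: F_def)
  text \<open>On \<open>[m, M]\<close> the convex function \<open>\<lambda>y. \<bar>y - F\<bar>\<close> lies below its chord.\<close>
  define chord where "chord t = ((M - f t) * (F - m) + (f t - m) * (M - F)) / (M - m)" for t
  have chord: "\<bar>f t - F\<bar> \<le> chord t" if "t \<in> {0..1}" for t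
  proof -
    have nn: "0 \<le> (M - f t) * (F - m)" "0 \<le> (f t - m) * (M - F)"
      using fb[OF that] \<open>m \<le> F\<close> \<open>F \<le> M\<close> by simp_all
    have "(f t - F) * (M - m) = (f t - m) * (M - F) - (M - f t) * (F - m)"
      by (simp add: algebra_simps)
    then have "\<bar>f t - F\<bar> * (M - m) \<le> (M - f t) * (F - m) + (f t - m) * (M - F)"
      using nn mM by (simp add: abs_if algebra_simps)
    then show ?thesis using mM by (simp add: chord_def le_divide_eq)
  qed
  have le: "g t * f t - F * g t - c * f t + c * F \<le> (b - a) / 2 * chord t" if "t \<in> {0..1}" for t
  proof -
    have "\<bar>g t - c\<bar> \<le> (b - a) / 2"
      unfolding abs_le_iff c_def using gb[OF that] by (simp add: field_simps)
    with chord[OF that] have "\<bar>f t - F\<bar> * \<bar>g t - c\<bar> \<le> chord t * ((b - a) / 2)"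
      by (intro mult_mono) auto
    then have "(f t - F) * (g t - c) \<le> chord t * ((b - a) / 2)"
      using abs_ge_self[of "(f t - F) * (g t - c)"] by (simp only: abs_mult)
    then show ?thesis by (simp add: algebra_simps)
  qed
  \<comment> \<open>Written as \<open>p + q * f t\<close>, the chord has as integral its value at
    the mean \<open>F\<close>.\<close>
  define p q where "p = (M * (F - m) - m * (M - F)) / (M - m)" and "q = (M - F - (F - m)) / (M - m)"
  have ch: "chord = (\<lambda>t. p + q * f t)"
    by (simp add: fun_eq_iff chord_def p_def q_def add_divide_distrib[symmetric] algebra_simps)
  have chi: "chord integrable_on {0..1}"
    unfolding ch by (intro integrable_add integrable_on_mult_right f) auto
  have "integral {0..1} chord = p + q * F"
    unfolding ch F_def by (subst integral_add) (auto intro!: integrable_on_mult_right f)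
  also have "\<dots> = 2 * ((M - F) * (F - m)) / (M - m)"
    by (simp add: p_def q_def add_divide_distrib[symmetric] algebra_simps)
  also have "\<dots> \<le> (M - m) / 2"
  proof -
    \<comment> \<open>Two numbers with sum \<open>M - m\<close> have product at most
      \<open>(M - m)\<^sup>2 / 4\<close>.\<close>
    have "0 \<le> (M - F - (F - m))\<^sup>2" by simp
    then have "4 * ((M - F) * (F - m)) \<le> (M - m)\<^sup>2" by (simp add: power2_eq_square algebra_simps)
    then show ?thesis using mM by (simp add: divide_le_eq power2_eq_square)
  qed
  finally have ci: "integral {0..1} chord \<le> (M - m) / 2" .
  have "integral {0..1} (\<lambda>t. g t * f t - F * g t - c * f t + c * F)
      \<le> integral {0..1} (\<lambda>t. (b - a) / 2 * chord t)"
    by (rule integral_le) (use le in \<open>auto intro!: integrable_add integrable_diff integrable_on_mult_right f g gf chi\<close>)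
  moreover have "integral {0..1} (\<lambda>t. g t * f t - F * g t - c * f t + c * F)
      = integral {0..1} (\<lambda>t. g t * f t) - F * integral {0..1} g - c * F + c * F"
    using has_integral_const_real[of F 0 1] integrable_integral[OF f, folded F_def]
    by (intro integral_unique has_integral_add has_integral_diff has_integral_mult_right
        integrable_integral gf g) simp_all
  moreover have "integral {0..1} (\<lambda>t. (b - a) / 2 * chord t) \<le> (b - a) / 2 * ((M - m) / 2)"
    using mult_left_mono[OF ci, of "(b - a) / 2"] ab by simp
  ultimately show ?thesis by (simp add: F_def mult.commute)
qed

section \<open>Integrability against a monotone weight\<close>

lemma integrable_on_is_interval_real:
  fixes f :: "real \<Rightarrow> 'b::banach"
  assumes "f integrable_on {a..b}" "is_interval S" "S \<subseteq> {a..b}"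
  shows "f integrable_on S"
proof -
  have sub: "closure S \<subseteq> {a..b}" using assms(3) by (simp add: closure_minimal)
  have "bounded S" using assms(3) bounded_closed_interval bounded_subset by blast
  then have "compact (closure S)" by (simp add: compact_closure)
  moreover have "connected (closure S)"
    using assms(2) by (simp add: connected_imp_connected_closure is_interval_connected_1)
  ultimately obtain c d where cd: "closure S = {c..d}" using connected_compact_interval_1 by blast
  have "f integrable_on closure S"
    using assms(1) sub unfolding cd by (rule integrable_subinterval_real)
  \<comment> \<open>What the closed interval adds to \<open>S\<close> lies in the frontier of a
    convex set.\<close>
  moreover have "negligible (closure S - S)"
  proof (rule negligible_subset)
    show "negligible (frontier S)"
      by (intro negligible_convex_frontier is_interval_convex assms(2))
    show "closure S - S \<subseteq> frontier S"
      using interior_subset by (auto simp: frontier_def)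
  qed
  then have "negligible (closure S - S \<union> (S - closure S))"
    using closure_subset[of S] by (simp add: Diff_eq_empty_iff[THEN iffD2])
  ultimately show ?thesis using integrable_spike_set_eq by blast
qed

text \<open>Rounding \<open>g\<close> down to multiples of \<open>1 / n\<close> gives a step
  function with finitely many values whose level sets are intervals by monotonicity. The error is at
  most \<open>K / n\<close> uniformly, and uniform limits preserve integrability, also for operator
  values.\<close>

lemma integrable_mono_scaleR:
  fixes F :: "real \<Rightarrow> 'b::banach"
  assumes F: "continuous_on {a..b} F" and g: "mono_on {a..b} g"
  shows "(\<lambda>t. g t *\<^sub>R F t) integrable_on {a..b}"
proof -
  obtain K where K: "\<And>t. t \<in> {a..b} \<Longrightarrow> norm (F t) \<le> K" and "K > 0"
    using compact_imp_bounded[OF compact_continuous_image[OF F compact_Icc]]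
    unfolding bounded_pos by (metis imageI)
  have "(\<lambda>t. g t *\<^sub>R F t) integrable_on cbox a b"
  proof (rule integrable_uniform_limit)
    fix e :: real assume "e > 0"
    then obtain n :: nat where n: "real n > K / e" "n > 0"
      by (metis reals_Archimedean2 divide_pos_pos \<open>K > 0\<close> of_nat_0_less_iff order_less_trans)
    define s where "s t = \<lfloor>real n * g t\<rfloor>" for t
    define J where "J = {s a..s b}"
    define S where "S j = {t \<in> {a..b}. s t = j}" for j
    have S_sub: "S j \<subseteq> {a..b}" for j by (auto simp: S_def)
    have s_mono: "s t \<le> s u" if "t \<in> {a..b}" "u \<in> {a..b}" "t \<le> u" for t u
      unfolding s_def using mono_onD[OF g that] by (intro floor_mono mult_left_mono) auto
    have "is_interval (S j)" for j
      unfolding is_interval_1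
    proof (intro ballI allI impI)
      fix t u w assume "t \<in> S j" "u \<in> S j" "t \<le> w \<and> w \<le> u"
      then show "w \<in> S j"
        using s_mono[of t w] s_mono[of w u] by (auto simp: S_def)
    qed
    then have "F integrable_on S j" for j
      by (rule integrable_on_is_interval_real[OF integrable_continuous_interval[OF F] _ S_sub])
    then have "(\<lambda>t. (real_of_int j / real n) *\<^sub>R F t) integrable_on S j" for j
      by (rule integrable_cmul)
    then have "(\<lambda>t. \<Sum>j\<in>J. if t \<in> S j then (real_of_int j / real n) *\<^sub>R F t else 0) integrable_on {a..b}"
      using S_sub by (intro integrable_sum) (simp_all add: J_def integrable_restrict_Int Int_absorb2)
    moreover have "(\<Sum>j\<in>J. if t \<in> S j then (real_of_int j / real n) *\<^sub>R F t else 0)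
        = (real_of_int (s t) / real n) *\<^sub>R F t" if "t \<in> {a..b}" for t
    proof -
      have "s t \<in> J" using that s_mono by (auto simp: J_def)
      \<comment> \<open>Each \<open>t\<close> lies in exactly one level set, so a single summand
        survives.\<close>
      then show ?thesis using that by (subst sum.remove[of _ "s t"]) (auto simp: S_def J_def)
    qed
    ultimately have "(\<lambda>t. (real_of_int (s t) / real n) *\<^sub>R F t) integrable_on {a..b}"
      by (rule integrable_eq)
    moreover have "norm (g t *\<^sub>R F t - (real_of_int (s t) / real n) *\<^sub>R F t) \<le> e" if "t \<in> {a..b}" for t
    proof -
      have "\<bar>g t - real_of_int (s t) / real n\<bar> = \<bar>real n * g t - real_of_int (s t)\<bar> / real n"
      proof -
        have "g t - real_of_int (s t) / real n = (real n * g t - real_of_int (s t)) / real n"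
          using n by (simp add: field_simps)
        then show ?thesis using n by simp
      qed
      also have "\<dots> \<le> 1 / real n"
        unfolding s_def by (intro divide_right_mono) linarith+
      finally have "\<bar>g t - real_of_int (s t) / real n\<bar> * norm (F t) \<le> 1 / real n * K"
        using K[OF that] by (intro mult_mono) auto
      also have "\<dots> \<le> e" using n \<open>e > 0\<close> by (simp add: field_simps)
      finally show ?thesis by (simp flip: scaleR_left_diff_distrib)
    qed
    ultimately show "\<exists>h. (\<forall>t\<in>cbox a b. norm (g t *\<^sub>R F t - h t) \<le> e) \<and> h integrable_on cbox a b"
      by (intro exI[of _ "\<lambda>t. (real_of_int (s t) / real n) *\<^sub>R F t"]) simp
  qed
  then show ?thesis by simp
qed

section \<open>Scalar power means\<close>

definition power_mean :: "real \<Rightarrow> real \<Rightarrow> real \<Rightarrow> real" where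
  "power_mean v t x = (if t = 0 then x powr v else ((1 - v) + v * x powr t) powr (1 / t))"

lemma power_mean_base_pos:
  fixes v x :: real
  shows "0 \<le> v \<Longrightarrow> v \<le> 1 \<Longrightarrow> 0 < x \<Longrightarrow> 0 < (1 - v) + v * x powr t"
  by (cases "v = 0") (auto intro!: add_nonneg_pos)

text \<open>For \<open>t > 0\<close> this is convexity of \<open>y powr (s / t)\<close> at the
  points \<open>1\<close> and \<open>x powr t\<close>; for \<open>t = 0\<close> it is the weighted
  AM-GM inequality for \<open>1\<close> and \<open>x powr s\<close>. In both cases a root of order
  \<open>s\<close> is taken.\<close>

lemma power_mean_mono:
  assumes v: "0 \<le> v" "v \<le> 1" and x: "0 < x" and t: "0 \<le> t" "t \<le> s"
  shows "power_mean v t x \<le> power_mean v s x"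
proof (cases "t = 0")
  case True
  show ?thesis
  proof (cases "s = 0")
    case False
    then have "s > 0" using t by simp
    have "(x powr s) powr v \<le> (1 - v) + v * x powr s"
      using Youngs_inequality_0[of "1 - v" v 1 "x powr s"] v x by simp
    then have "((x powr s) powr v) powr (1 / s) \<le> ((1 - v) + v * x powr s) powr (1 / s)"
      using \<open>s > 0\<close> by (intro powr_mono2) auto
    then show ?thesis using True False by (simp add: power_mean_def powr_powr)
  qed (use True in simp)
next
  case False
  then have "t > 0" "s > 0" using t by auto
  have "convex_on {0<..} (\<lambda>y. y powr (s / t))"
    using t \<open>t > 0\<close> by (intro powr_convex) simp
  from convex_onD[OF this, of v 1 "x powr t"]
  have "((1 - v) + v * x powr t) powr (s / t) \<le> (1 - v) + v * x powr s"
    using v x \<open>t > 0\<close> by (simp add: powr_powr)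
  then have "(((1 - v) + v * x powr t) powr (s / t)) powr (1 / s) \<le> ((1 - v) + v * x powr s) powr (1 / s)"
    using \<open>s > 0\<close> by (intro powr_mono2) auto
  then show ?thesis using \<open>t > 0\<close> \<open>s > 0\<close> by (simp add: power_mean_def powr_powr)
qed

text \<open>Joint continuity at \<open>t = 0\<close>: with \<open>l = ln x\<close> the logarithm of the power mean is
  \<open>l * h (t * l)\<close>, where \<open>h u = ln (1 - v + v * exp u) / u\<close> extends continuously by \<open>h 0 = v\<close>.\<close>

lemma continuous_on_power_mean:
  assumes v: "0 \<le> v" "v \<le> 1" and \<xi>: "continuous_on S \<xi>" "\<And>x. x \<in> S \<Longrightarrow> 0 < \<xi> x"
  shows "continuous_on (U \<times> S) (\<lambda>(t, x). power_mean v t (\<xi> x))"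
proof -
  define q where "q u = ln ((1 - v) + v * exp u)" for u
  define h where "h u = (if u = 0 then v else q u / u)" for u
  have pos: "0 < (1 - v) + v * exp u" for u
    using power_mean_base_pos[OF v, of "exp u" 1] by simp
  have dq: "(q has_real_derivative (v * exp u / ((1 - v) + v * exp u))) (at u)" for u
    unfolding q_def using pos[of u] by (auto intro!: derivative_eq_intros)
  have "isCont h u" for u
  proof (cases "u = 0")
    case True
    \<comment> \<open>As \<open>q 0 = 0\<close>, the quotient \<open>q u / u\<close> is the
      difference quotient of \<open>q\<close> at \<open>0\<close>, where the derivative is
      \<open>v\<close>.\<close>
    have "((\<lambda>u. (q u - q 0) / (u - 0)) \<longlongrightarrow> v) (at 0)"
      using dq[of 0] by (simp add: has_field_derivative_iff)
    then have "(\<lambda>u. q u / u) \<midarrow>0\<rightarrow> v" by (simp add: q_def)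
    then have "h \<midarrow>0\<rightarrow> v"
      by (rule Lim_transform_eventually) (auto simp: h_def eventually_at intro!: exI[of _ 1])
    then show ?thesis using True by (simp add: isCont_def h_def)
  next
    case False
    have "isCont (\<lambda>u. q u / u) u"
      using False DERIV_isCont[OF dq] by (intro continuous_intros)
    then show ?thesis
      by (rule continuous_transform_within[of _ _ _ "\<bar>u\<bar>"])
         (use False in \<open>auto simp: h_def dist_real_def\<close>)
  qed
  then have h: "continuous_on UNIV h" by (simp add: continuous_on_eq_continuous_at)
  have eq: "power_mean v t (\<xi> x) = exp (ln (\<xi> x) * h (t * ln (\<xi> x)))" if "x \<in> S" for t x
  proof -
    have p: "0 < \<xi> x" using \<xi>(2) that by simp
    have e: "exp (t * ln (\<xi> x)) = \<xi> x powr t" using p by (simp add: powr_def)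
    \<comment> \<open>The quotient in \<open>h\<close> is genuine only if
      \<open>t * ln (\<xi> x)\<close> is nonzero. Otherwise either \<open>t = 0\<close> and
      \<open>h 0 = v\<close> gives the geometric mean, or \<open>\<xi> x = 1\<close> and both sides
      are \<open>1\<close>.\<close>
    consider "t = 0" | "t \<noteq> 0" "ln (\<xi> x) = 0" | "t \<noteq> 0" "ln (\<xi> x) \<noteq> 0" by blast
    then show ?thesis
    proof cases
      case 1
      then show ?thesis using p by (simp add: power_mean_def h_def powr_def mult.commute)
    next
      case 2
      then show ?thesis using p by (simp add: power_mean_def powr_def)
    next
      case 3
      have "\<xi> x \<noteq> 0" using p by simp
      moreover have "ln (\<xi> x) * h (t * ln (\<xi> x)) = 1 / t * ln ((1 - v) + v * \<xi> x powr t)"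
        using 3 by (simp add: h_def q_def e)
      ultimately show ?thesis
        using 3 power_mean_base_pos[OF v p, of t] by (simp add: power_mean_def powr_def[of "_ + _"])
    qed
  qed
  have lx: "continuous_on (U \<times> S) (\<lambda>p. ln (\<xi> (snd p)))"
    by (intro continuous_on_ln continuous_on_compose2[OF \<xi>(1)] continuous_intros) (use \<xi>(2) in force)+
  have "continuous_on (U \<times> S) (\<lambda>p. exp (ln (\<xi> (snd p)) * h (fst p * ln (\<xi> (snd p)))))"
    by (intro continuous_on_exp continuous_on_mult lx continuous_on_compose2[OF h]
        continuous_on_fst continuous_on_id) auto
  then show ?thesis
    by (rule continuous_on_eq) (auto simp: eq)
qed

section \<open>Operator means\<close>

text \<open>The quadratic polynomial \<open>r \<mapsto> inner (X (x - r y)) (x - r y)\<close> is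
  nonnegative; it is evaluated at its minimizer, with the degenerate leading coefficient treated
  apart.\<close>

lemma positive_op_cauchy_schwarz:
  assumes "positive_op X"
  shows "(inner (X x) y)\<^sup>2 \<le> inner (X x) x * inner (X y) y"
proof -
  have sa: "inner (X y) x = inner (X x) y" for x y
    using assms by (metis inner_commute positive_op_def selfadj_def)
  have q: "0 \<le> inner (X x) x - 2 * r * inner (X x) y + r\<^sup>2 * inner (X y) y" for r
  proof -
    have "0 \<le> inner (X (x - r *\<^sub>R y)) (x - r *\<^sub>R y)"
      using assms by (simp add: positive_op_def)
    also have "\<dots> = inner (X x) x - 2 * r * inner (X x) y + r\<^sup>2 * inner (X y) y"
      by (simp add: blinfun.bilinear_simps inner_simps sa[of y x] power2_eq_square algebra_simps)
    finally show ?thesis .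
  qed
  have nn: "0 \<le> inner (X y) y" using assms by (simp add: positive_op_def)
  show ?thesis
  proof (cases "inner (X y) y = 0")
    case True
    have "inner (X x) y = 0"
    proof (rule ccontr)
      assume "inner (X x) y \<noteq> 0"
      \<comment> \<open>With zero leading coefficient this \<open>r\<close> makes the polynomial
        equal to \<open>-1\<close>.\<close>
      then show False
        using q[of "(inner (X x) x + 1) / (2 * inner (X x) y)"] True by simp
    qed
    then show ?thesis using True by simp
  next
    case False
    then have "inner (X y) y > 0" using nn by simp
    then show ?thesis
      using q[of "inner (X x) y / inner (X y) y"] by (simp add: power2_eq_square field_simps)
  qed
qed

text \<open>Invertibility becomes a spectral gap through Cauchy-Schwarz for the form of
  \<open>X\<close> at \<open>x\<close> and \<open>C x\<close>, because
  \<open>inner (X x) (C x)\<close> is the squared norm of \<open>x\<close>. The \<open>+ 1\<close>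
  in \<open>a\<close> guards against \<open>norm C = 0\<close>.\<close>

lemma pos_invertible_lower_bound:
  assumes "pos_invertible X"
  obtains a where "a > 0" "positive_op (X - a *\<^sub>R id_blinfun)"
proof -
  obtain C where C: "X o\<^sub>L C = id_blinfun" and X: "positive_op X"
    using assms by (auto simp: pos_invertible_def invertible_op_def)
  have XC: "X (C x) = x" for x using C by (metis blinfun_apply_blinfun_compose blinfun_apply_id_blinfun)
  have sa: "selfadj X" using X by (simp add: positive_op_def)
  define a where "a = 1 / (norm C + 1)"
  have "a > 0" by (simp add: a_def add_nonneg_pos)
  moreover have "positive_op (X - a *\<^sub>R id_blinfun)"
    unfolding positive_op_def
  proof (intro conjI allI selfadj_diff selfadj_scaleR selfadj_id sa)
    fix x
    have xx: "inner (X x) (C x) = (norm x)\<^sup>2"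
      using sa XC by (simp add: selfadj_def power2_norm_eq_inner)
    have "inner x (C x) \<le> norm x * (norm C * norm x)"
      by (rule order_trans[OF norm_cauchy_schwarz]) (intro mult_left_mono norm_blinfun norm_ge_zero)
    also have "\<dots> \<le> (norm C + 1) * (norm x)\<^sup>2" by (simp add: power2_eq_square algebra_simps)
    finally have xC: "inner x (C x) \<le> (norm C + 1) * (norm x)\<^sup>2" .
    have "((norm x)\<^sup>2)\<^sup>2 \<le> inner (X x) x * inner x (C x)"
      using positive_op_cauchy_schwarz[OF X, of x "C x"] by (simp add: xx XC)
    also have "\<dots> \<le> inner (X x) x * ((norm C + 1) * (norm x)\<^sup>2)"
      using X xC by (intro mult_left_mono) (auto simp: positive_op_def)
    finally have "(norm x)\<^sup>2 * (norm x)\<^sup>2 \<le> (norm x)\<^sup>2 * (inner (X x) x * (norm C + 1))"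
      by (simp add: power2_eq_square ac_simps)
    from mult_left_le_imp_le[OF this] have "(norm x)\<^sup>2 \<le> inner (X x) x * (norm C + 1)"
      by (cases "x = 0") (simp_all add: blinfun.zero_right)
    then have "a * (norm x)\<^sup>2 \<le> inner (X x) x"
      by (simp add: a_def divide_le_eq add_nonneg_pos)
    then show "0 \<le> inner ((X - a *\<^sub>R id_blinfun) x) x"
      by (simp add: blinfun.bilinear_simps inner_simps power2_norm_eq_inner)
  qed
  ultimately show thesis using that by blast
qed

text \<open>An affine map moves \<open>X\<close> into the unit interval, and \<open>\<xi>\<close> is
  the inverse affine map, positive because \<open>a > 0\<close>.\<close>

lemma opfun_representation:
  fixes X :: "('a::{real_inner, complete_space}) op"
  assumes "selfadj X" and a: "a > 0" "positive_op (X - a *\<^sub>R id_blinfun)"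
  obtains T \<xi> where "pos_contraction T" "continuous_on {0..1} \<xi>" "\<And>x. x \<in> {0..1} \<Longrightarrow> 0 < \<xi> x" "X = opfun T \<xi>"
proof -
  \<comment> \<open>This \<open>b\<close> exceeds \<open>a\<close> and dominates
    \<open>norm X\<close>, so \<open>X\<close> lies below \<open>b\<close> times the
    identity.\<close>
  define b where "b = max a (norm X) + 1"
  have "b > a" by (simp add: b_def)
  define T where "T = (1 / (b - a)) *\<^sub>R (X - a *\<^sub>R id_blinfun)"
  have "id_blinfun - T = (1 / (b - a)) *\<^sub>R ((b - a) *\<^sub>R id_blinfun - (X - a *\<^sub>R id_blinfun))"
    unfolding T_def scaleR_diff_right[of _ "(b - a) *\<^sub>R id_blinfun"] using \<open>b > a\<close> by simp
  also have "(b - a) *\<^sub>R id_blinfun - (X - a *\<^sub>R id_blinfun) = b *\<^sub>R id_blinfun - X"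
    by (simp add: algebra_simps)
  finally have "positive_op (id_blinfun - T)"
    using \<open>b > a\<close> positive_op_norm_diff[OF assms(1), of b] by (simp add: positive_op_scaleR b_def)
  moreover have "positive_op T"
    unfolding T_def using \<open>b > a\<close> a by (intro positive_op_scaleR) auto
  ultimately have T: "pos_contraction T" by unfold_locales
  interpret pos_contraction T by (fact T)
  have "opfun T (\<lambda>x. a + (b - a) * x) = a *\<^sub>R id_blinfun + (b - a) *\<^sub>R T"
    by (subst opfun_add) (auto intro!: continuous_intros simp: opfun_const opfun_scaleR opfun_ident)
  also have "\<dots> = X" using \<open>b > a\<close> by (simp add: T_def)
  finally have "X = opfun T (\<lambda>x. a + (b - a) * x)" by simp
  moreover have "continuous_on {0..1} (\<lambda>x. a + (b - a) * x)" by (intro continuous_intros)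
  moreover have "0 < a + (b - a) * x" if "x \<in> {0..1}" for x
    using that a \<open>b > a\<close> by (intro add_pos_nonneg) auto
  ultimately show thesis using T that by blast
qed

lemma op_powr_half:
  fixes A :: "('a::{real_inner, complete_space}) op"
  assumes "pos_invertible A"
  shows "selfadj (op_powr A (1/2))" "selfadj (op_powr A (-1/2))"
    "op_powr A (1/2) o\<^sub>L op_powr A (1/2) = A"
    "op_powr A (1/2) o\<^sub>L op_powr A (-1/2) = id_blinfun"
    "op_powr A (-1/2) o\<^sub>L op_powr A (1/2) = id_blinfun"
proof -
  obtain a where a: "a > 0" "positive_op (A - a *\<^sub>R id_blinfun)"
    using pos_invertible_lower_bound[OF assms] .
  have "selfadj A" using assms by (simp add: pos_invertible_def positive_op_def)
  then obtain T \<xi> where T: "pos_contraction T" and c: "continuous_on {0..1} \<xi>"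
    and p: "\<And>x. x \<in> {0..1} \<Longrightarrow> 0 < \<xi> x" and A: "A = opfun T \<xi>"
    using opfun_representation[OF _ a] by blast
  interpret pos_contraction T by (fact T)
  have pw: "op_powr A t = opfun T (\<lambda>x. \<xi> x powr t)" for t
    unfolding A by (rule op_powr_opfun[OF c p])
  have cont: "continuous_on {0..1} (\<lambda>x. \<xi> x powr t)" for t
    by (intro continuous_intros c) (use p in force)
  show "selfadj (op_powr A (1/2))" "selfadj (op_powr A (-1/2))"
    unfolding pw by (intro selfadj_opfun cont)+
  have mult: "op_powr A s o\<^sub>L op_powr A t = opfun T (\<lambda>x. \<xi> x powr (s + t))" for s t
    unfolding pw opfun_mult[OF cont cont, symmetric] by (simp add: powr_add)
  have "opfun T (\<lambda>x. \<xi> x powr 1) = A" "opfun T (\<lambda>x. \<xi> x powr 0) = opfun T (\<lambda>_. 1)"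
    unfolding A using p by (force intro: opfun_cong)+
  then show "op_powr A (1/2) o\<^sub>L op_powr A (1/2) = A"
    "op_powr A (1/2) o\<^sub>L op_powr A (-1/2) = id_blinfun"
    "op_powr A (-1/2) o\<^sub>L op_powr A (1/2) = id_blinfun"
    by (simp_all add: mult opfun_const)
qed

text \<open>On the compact square \<open>K\<close> is uniformly continuous, so \<open>K s\<close>
  and \<open>K t\<close> are close in sup norm when \<open>s\<close> is near \<open>t\<close>;
  \<open>opfun_norm\<close> transfers this to operators.\<close>

lemma (in pos_contraction) continuous_on_opfun:
  fixes K :: "real \<Rightarrow> real \<Rightarrow> real"
  assumes K: "continuous_on ({0..1} \<times> {0..1}) (\<lambda>(t, x). K t x)"
  shows "continuous_on {0..1} (\<lambda>t. opfun T (K t))"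
proof -
  have c: "continuous_on {0..1} (K t)" if "t \<in> {0..1}" for t
  proof -
    have "continuous_on {0..1} (\<lambda>x. (\<lambda>(t, x). K t x) (t, x))"
      by (rule continuous_on_compose2[OF K]) (use that in \<open>auto intro!: continuous_intros\<close>)
    then show ?thesis by simp
  qed
  have "compact ({0..1::real} \<times> {0..1::real})" by (intro compact_Times compact_Icc)
  then have u: "uniformly_continuous_on ({0..1} \<times> {0..1}) (\<lambda>(t, x). K t x)"
    using K compact_uniformly_continuous by blast
  show ?thesis
    unfolding continuous_on_iff
  proof (intro ballI allI impI)
    fix t e :: real assume t: "t \<in> {0..1}" and "0 < e"
    then obtain d where "d > 0" and d: "\<And>p q. p \<in> {0..1} \<times> {0..1} \<Longrightarrow> q \<in> {0..1} \<times> {0..1} \<Longrightarrow>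
        dist q p < d \<Longrightarrow> dist (case q of (t, x) \<Rightarrow> K t x) (case p of (t, x) \<Rightarrow> K t x) < e / 2"
      using u unfolding uniformly_continuous_on_def by (meson half_gt_zero)
    have "dist (opfun T (K s)) (opfun T (K t)) < e" if s: "s \<in> {0..1}" "dist s t < d" for s
    proof -
      have "norm (opfun T (\<lambda>x. K s x - K t x)) \<le> e / 2"
      proof (rule opfun_norm)
        show "\<bar>K s x - K t x\<bar> \<le> e / 2" if "x \<in> {0..1}" for x
          using d[of "(t, x)" "(s, x)"] that s t by (simp add: dist_Pair_Pair dist_real_def)
      qed (intro continuous_on_diff c s t)
      then show ?thesis
        using \<open>0 < e\<close> opfun_diff[OF c[OF s(1)] c[OF t]] by (simp add: dist_norm)
    qed
    then show "\<exists>d>0. \<forall>s\<in>{0..1}. dist s t < d \<longrightarrow> dist (opfun T (K s)) (opfun T (K t)) < e"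
      using \<open>d > 0\<close> by blast
  qed
qed

text \<open>One \<open>T\<close> and one \<open>\<xi>\<close> serve all \<open>t\<close>, so that
  statements about the whole path reduce to the functions \<open>power_mean v t (\<xi> x)\<close>.
  Here \<open>S\<close> is the square root of \<open>A\<close>.\<close>

lemma pmean_representation:
  fixes A B :: "('a::{real_inner, complete_space}) op"
  assumes A: "pos_invertible A" and B: "pos_invertible B" and v: "0 \<le> v" "v \<le> 1"
  obtains T S \<xi> where "pos_contraction T" "selfadj S" "continuous_on {0..1} \<xi>"
    "\<And>x. x \<in> {0..1} \<Longrightarrow> 0 < \<xi> x"
    "\<And>t. pmean t v A B = S o\<^sub>L opfun T (\<lambda>x. power_mean v t (\<xi> x)) o\<^sub>L S"
    "S o\<^sub>L S = A" "S o\<^sub>L opfun T \<xi> o\<^sub>L S = B"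
proof -
  define S R where "S = op_powr A (1/2)" and "R = op_powr A (-1/2)"
  note SR = op_powr_half[OF A, folded S_def R_def]
  define X where "X = R o\<^sub>L B o\<^sub>L R"
  obtain b where b: "b > 0" "positive_op (B - b *\<^sub>R id_blinfun)"
    using pos_invertible_lower_bound[OF B] .
  have saX: "selfadj X"
    unfolding X_def using B SR(2) by (intro selfadj_sandwich) (auto simp: pos_invertible_def positive_op_def)
  \<comment> \<open>From \<open>x = S (R x)\<close> the squared norm of \<open>R x\<close> is at
    least that of \<open>x\<close> divided by \<open>(norm S)\<^sup>2 + 1\<close>, and
    \<open>B\<close> is bounded below by \<open>b\<close>.\<close>
  define a where "a = b / ((norm S)\<^sup>2 + 1)"
  have "a > 0" using b by (simp add: a_def add_nonneg_pos)
  have "positive_op (X - a *\<^sub>R id_blinfun)"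
    unfolding positive_op_def
  proof (intro conjI allI selfadj_diff selfadj_scaleR selfadj_id saX)
    fix x
    have "S (R x) = x" using SR(4) by (metis blinfun_apply_blinfun_compose blinfun_apply_id_blinfun)
    then have "(norm x)\<^sup>2 \<le> (norm S * norm (R x))\<^sup>2"
      using norm_blinfun[of S "R x"] by (intro power_mono) auto
    also have "\<dots> \<le> ((norm S)\<^sup>2 + 1) * (norm (R x))\<^sup>2" by (simp add: power_mult_distrib algebra_simps)
    finally have "a * (norm x)\<^sup>2 \<le> b * (norm (R x))\<^sup>2"
      using b by (simp add: a_def divide_le_eq add_nonneg_pos mult.commute mult.left_commute)
    also have "\<dots> \<le> inner (B (R x)) (R x)"
      using b(2) by (simp add: positive_op_def blinfun.bilinear_simps inner_simps power2_norm_eq_inner)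
    also have "\<dots> = inner (X x) x"
      using SR(2) by (simp add: X_def selfadj_def)
    finally show "0 \<le> inner ((X - a *\<^sub>R id_blinfun) x) x"
      by (simp add: blinfun.bilinear_simps inner_simps power2_norm_eq_inner)
  qed
  from opfun_representation[OF saX \<open>a > 0\<close> this] obtain T \<xi> where T: "pos_contraction T"
    and c: "continuous_on {0..1} \<xi>" and p: "\<And>x. x \<in> {0..1} \<Longrightarrow> 0 < \<xi> x" and X: "X = opfun T \<xi>"
    by blast
  interpret pos_contraction T by (fact T)
  have cont: "continuous_on {0..1} (\<lambda>x. \<xi> x powr t)" for t
    by (intro continuous_intros c) (use p in force)
  have pw: "op_powr X t = opfun T (\<lambda>x. \<xi> x powr t)" for t
    unfolding X by (rule op_powr_opfun[OF c p])
  have "op_powr ((1 - v) *\<^sub>R id_blinfun + v *\<^sub>R op_powr X t) (1 / t)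
      = opfun T (\<lambda>x. ((1 - v) + v * \<xi> x powr t) powr (1 / t))" for t
  proof -
    have "(1 - v) *\<^sub>R id_blinfun + v *\<^sub>R op_powr X t = opfun T (\<lambda>x. (1 - v) + v * \<xi> x powr t)"
      by (simp only: opfun_add[OF continuous_on_const continuous_on_mult[OF continuous_on_const cont]]
          opfun_scaleR[OF cont] opfun_const pw)
    then show ?thesis
      by (simp only:) (intro op_powr_opfun power_mean_base_pos v p continuous_intros cont)
  qed
  then have "pmean t v A B = S o\<^sub>L opfun T (\<lambda>x. power_mean v t (\<xi> x)) o\<^sub>L S" for t
    unfolding pmean_def gmean_def S_def[symmetric] R_def[symmetric] X_def[symmetric]
    by (simp add: power_mean_def pw)
  moreover have "S o\<^sub>L opfun T \<xi> o\<^sub>L S = B"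
  proof -
    have "S o\<^sub>L X o\<^sub>L S = (S o\<^sub>L R) o\<^sub>L B o\<^sub>L (R o\<^sub>L S)"
      by (simp add: X_def op_compose_assoc)
    then show ?thesis by (simp add: X SR)
  qed
  ultimately show thesis using that[OF T SR(1) c p] SR(3) by blast
qed

section \<open>Quadratic forms of operator integrals and the inequality of means\<close>

lemma inner_integral_op:
  assumes "F integrable_on {0..1}"
  shows "inner (blinfun_apply (integral {0..1} F) x) y = integral {0..1} (\<lambda>t::real. inner (F t x) y)"
    and "(\<lambda>t::real. inner (F t x) y) integrable_on {0..1}"
proof -
  \<comment> \<open>Evaluation at \<open>x\<close> and \<open>y\<close> is a bounded functional on
    operators, so it commutes with the norm integral.\<close>
  have "bounded_linear (\<lambda>X. inner (blinfun_apply X x) y)"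
    by (intro bounded_linear_intros)
  from integral_linear[OF assms this] integrable_linear[OF assms this]
  show "inner (blinfun_apply (integral {0..1} F) x) y = integral {0..1} (\<lambda>t. inner (F t x) y)"
    and "(\<lambda>t. inner (F t x) y) integrable_on {0..1}"
    by (simp_all add: o_def)
qed

lemma selfadj_integral:
  assumes "F integrable_on {0..1::real}" "\<And>t. selfadj (F t)"
  shows "selfadj (integral {0..1} F)"
  unfolding selfadj_def
proof (intro allI)
  fix x y
  have "inner (F t y) x = inner (F t x) y" for t
    using assms(2) by (metis inner_commute selfadj_def)
  then have "inner (integral {0..1} F y) x = inner (integral {0..1} F x) y"
    unfolding inner_integral_op(1)[OF assms(1)] by presburger
  then show "inner (integral {0..1} F x) y = inner x (integral {0..1} F y)"
    by (simp add: inner_commute)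
qed

text \<open>A complex Hilbert space is presented as a real one with \<open>J\<close> as
  multiplication by the imaginary unit; the real inner product is the real part of the complex one,
  and complex-linear operators are those that commute with \<open>J\<close>. For these,
  self-adjointness with respect to either inner product is the same.\<close>

theorem theorem3p3:
  fixes A B J :: "('a::{real_inner, complete_space}) \<Rightarrow>\<^sub>L 'a"
    and v :: real and g :: "real \<Rightarrow> real"
  assumes J_sq: "J o\<^sub>L J = - id_blinfun"
    and J_skew: "\<forall>x y. inner (J x) y = - inner x (J y)"
    and A_clin: "A o\<^sub>L J = J o\<^sub>L A"
    and B_clin: "B o\<^sub>L J = J o\<^sub>L B"
    and A_pos: "pos_invertible A"
    and B_pos: "pos_invertible B"
    and v: "0 \<le> v" "v \<le> 1"
    and g_mono: "mono_on {0..1} g"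
    and g_ne: "g 1 \<noteq> g 0"
  shows "loewner_le
     (gmean A v B
      + (4 / (g 1 - g 0)) *\<^sub>R
          (integral {0..1} (\<lambda>t. g t *\<^sub>R pmean t v A B)
           - integral {0..1} g *\<^sub>R integral {0..1} (\<lambda>t. pmean t v A B)))
     (amean A v B)"
proof -
  obtain T S \<xi> where T: "pos_contraction T" and S: "selfadj S" and c: "continuous_on {0..1} \<xi>"
    and p: "\<And>x. x \<in> {0..1} \<Longrightarrow> 0 < \<xi> x"
    and pm: "\<And>t. pmean t v A B = S o\<^sub>L opfun T (\<lambda>x. power_mean v t (\<xi> x)) o\<^sub>L S"
    and SS: "S o\<^sub>L S = A" and SXS: "S o\<^sub>L opfun T \<xi> o\<^sub>L S = B"
    by (rule pmean_representation[OF A_pos B_pos v]) (rule that)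
  interpret pos_contraction T by (fact T)
  define P where "P t = pmean t v A B" for t
  have K: "continuous_on (U \<times> {0..1}) (\<lambda>(t, x). power_mean v t (\<xi> x))" for U
    by (rule continuous_on_power_mean[OF v c p])
  have pmc: "continuous_on {0..1} (\<lambda>x. power_mean v t (\<xi> x))" for t
  proof -
    have "continuous_on {0..1} (\<lambda>x. (\<lambda>(t, x). power_mean v t (\<xi> x)) (t, x))"
      by (rule continuous_on_compose2[OF K[of UNIV]]) (auto intro!: continuous_intros)
    then show ?thesis by simp
  qed
  have saP: "selfadj (P t)" for t
    unfolding P_def pm by (intro selfadj_sandwich S selfadj_opfun pmc)
  have Pc: "continuous_on {0..1} P"
    unfolding P_def[abs_def] pm
    by (intro bounded_bilinear.continuous_on[OF bounded_bilinear_blinfun_compose]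
        continuous_on_const continuous_on_opfun K)
  \<comment> \<open>The quadratic form of \<open>P t\<close> at \<open>x\<close> is that of the
    middle factor at \<open>S x\<close>, where scalar monotonicity applies.\<close>
  have Pmono: "inner (P s x) x \<le> inner (P t x) x" if "0 \<le> s" "s \<le> t" for s t x
  proof -
    have "positive_op (opfun T (\<lambda>x. power_mean v t (\<xi> x) - power_mean v s (\<xi> x)))"
      using power_mean_mono[OF v p that] by (intro opfun_positive continuous_on_diff pmc) auto
    then have "0 \<le> inner ((opfun T (\<lambda>x. power_mean v t (\<xi> x)) - opfun T (\<lambda>x. power_mean v s (\<xi> x))) (S x)) (S x)"
      by (simp add: opfun_diff pmc positive_op_def)
    then show ?thesis
      using S by (simp add: P_def pm selfadj_def blinfun.bilinear_simps inner_simps)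
  qed
  have Pi: "P integrable_on {0..1}" by (rule integrable_continuous_interval[OF Pc])
  have gPi: "(\<lambda>t. g t *\<^sub>R P t) integrable_on {0..1}" by (rule integrable_mono_scaleR[OF Pc g_mono])
  have gi: "g integrable_on {0..1}"
    using integrable_mono_scaleR[OF continuous_on_const g_mono, of "1::real"] by simp
  have gb: "g 0 \<le> g t \<and> g t \<le> g 1" if "t \<in> {0..1}" for t
    using mono_onD[OF g_mono, of 0 t] mono_onD[OF g_mono, of t 1] that by simp
  have g01: "g 0 < g 1" using gb[of 0] g_ne by simp
  have P0: "gmean A v B = P 0" by (simp add: P_def pmean_def)
  have P1: "amean A v B = P 1"
  proof -
    have "opfun T (\<lambda>x. power_mean v 1 (\<xi> x)) = opfun T (\<lambda>x. (1 - v) + v * \<xi> x)"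
    proof (rule opfun_cong)
      show "power_mean v 1 (\<xi> x) = (1 - v) + v * \<xi> x" if "x \<in> {0..1}" for x
        using p[OF that] power_mean_base_pos[OF v p[OF that], of 1] by (simp add: power_mean_def)
    qed
    also have "\<dots> = (1 - v) *\<^sub>R id_blinfun + v *\<^sub>R opfun T \<xi>"
      by (simp only: opfun_add[OF continuous_on_const continuous_on_mult[OF continuous_on_const c]]
          opfun_scaleR[OF c] opfun_const)
    finally have "P 1 = (1 - v) *\<^sub>R (S o\<^sub>L S) + v *\<^sub>R (S o\<^sub>L opfun T \<xi> o\<^sub>L S)"
      by (simp add: P_def pm op_bilinear)
    then show ?thesis by (simp add: amean_def SS SXS)
  qed
  define D where "D = integral {0..1} (\<lambda>t. g t *\<^sub>R P t) - integral {0..1} g *\<^sub>R integral {0..1} P"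
  have "selfadj D"
    unfolding D_def by (intro selfadj_diff selfadj_scaleR selfadj_integral Pi gPi saP)
  moreover have "inner (D x) x \<le> (inner (P 1 x) x - inner (P 0 x) x) * (g 1 - g 0) / 4" for x
  proof -
    have "inner (D x) x = integral {0..1} (\<lambda>t. g t * inner (P t x) x)
        - integral {0..1} g * integral {0..1} (\<lambda>t. inner (P t x) x)"
      using inner_integral_op(1)[OF gPi, of x x] inner_integral_op(1)[OF Pi, of x x]
      by (simp add: D_def blinfun.bilinear_simps inner_simps)
    \<comment> \<open>Monotonicity supplies the bounds: the form of \<open>P t\<close> runs between
      its values at \<open>0\<close> and \<open>1\<close>, and \<open>g t\<close> between
      \<open>g 0\<close> and \<open>g 1\<close>.\<close>
    also have "\<dots> \<le> (inner (P 1 x) x - inner (P 0 x) x) * (g 1 - g 0) / 4"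
      using inner_integral_op(2)[OF gPi, of x x] inner_integral_op(2)[OF Pi, of x x]
      by (intro gruess_inequality gi gb) (auto simp: blinfun.scaleR_left intro: Pmono)
    finally show ?thesis .
  qed
  then have "(4 / (g 1 - g 0)) * inner (D x) x \<le> inner (P 1 x) x - inner (P 0 x) x" for x
    using g01 by (simp add: field_simps)
  ultimately have "loewner_le (P 0 + (4 / (g 1 - g 0)) *\<^sub>R D) (P 1)"
    unfolding loewner_le_def positive_op_def
    by (auto intro!: selfadj_diff selfadj_add selfadj_scaleR saP simp: blinfun.bilinear_simps inner_simps algebra_simps)
  then show ?thesis by (simp add: P0 P1 D_def P_def[abs_def])
qed

end
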